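(* Under the same setting as the previous theorem ($\mathbf H=\mathbf g\mathbf h^T$ with unit-modulus $\mathbf g\in\mathbb C^{M_R},\mathbf h\in\mathbb C^{M_T}$; $\mathrm{vec}(\mathbf\Phi)\sim\mathcal N(\mathbf 0,\sigma^2\mathbf I)$; $\hat{\mathbf H}=\mathbf H\circ(\mathbf 1+j\mathbf\Phi)$; $\hat C=\mathbb E\{\log_2\det(\mathbf I+\frac{\rho}{M_T}\hat{\mathbf H}\hat{\mathbf H}^H)\}$), if $M_R\le M_T$ then $$\hat C\ge\sum_{i=0}^{M_R-1}\log_2\Big(1+\frac{\rho}{M_T}\Big(M_TM_R\delta_i+2\sigma^2e^{\psi\left(\frac{M_T-i}{2}\right)}\Big)\Big),$$ and if $M_R>M_T$ then $$\hat C\ge\sum_{i=0}^{M_T-1}\log_2\Big(1+\frac{\rho}{M_T}\Big(M_TM_R\delta_i+2\sigma^2e^{\psi\left(\frac{M_R-i}{2}\right)}\Big)\Big).$$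
   Context: $\rho>0$, $\sigma^2>0$; $\circ$ is the Hadamard product, $\mathbf 1$ the all-ones matrix, $\delta_i=1$ if $i=0$ and $0$ otherwise, $\psi$ is the digamma function $\Gamma'/\Gamma$. *)

theory Defs
  imports "HOL-Analysis.Analysis" "HOL-Probability.Probability"
begin

definition cmat_adj :: "complex^'m^'n \<Rightarrow> complex^'n^'m" where
  "cmat_adj A = (\<chi> i j. cnj (A $ j $ i))"

definition hadamard :: "complex^'m^'n \<Rightarrow> complex^'m^'n \<Rightarrow> complex^'m^'n" where
  "hadamard A B = (\<chi> i j. A $ i $ j * B $ i $ j)"

definition los_channel :: "complex^'r \<Rightarrow> complex^'t \<Rightarrow> complex^'t^'r" where
  "los_channel g h = (\<chi> i j. g $ i * h $ j)"

definition noisy_channel :: "complex^'r \<Rightarrow> complex^'t \<Rightarrow> ('r \<times> 't \<Rightarrow> real) \<Rightarrow> complex^'t^'r" where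
  "noisy_channel g h \<Phi> =
     hadamard (los_channel g h) (\<chi> i j. 1 + \<i> * complex_of_real (\<Phi> (i, j)))"

definition phase_noise_measure :: "real \<Rightarrow> ('r::finite \<times> 't::finite \<Rightarrow> real) measure" where
  "phase_noise_measure \<sigma>2 = PiM UNIV (\<lambda>_. density lborel (normal_density 0 (sqrt \<sigma>2)))"

text \<open>Instantaneous rate log2 det(I + rho/M_T Hhat Hhat^H) (the determinant is real).\<close>
definition inst_rate :: "real \<Rightarrow> complex^'t^'r \<Rightarrow> real" where
  "inst_rate \<rho> A = log 2 (Re (det (mat 1 +
      (\<rho> / real CARD('t)) *\<^sub>R (A ** cmat_adj A))))"

definition cap_hat :: "real \<Rightarrow> real \<Rightarrow> complex^'r::finite \<Rightarrow> complex^'t::finite \<Rightarrow> real" where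
  "cap_hat \<rho> \<sigma>2 g h =
     (\<integral>\<Phi>. inst_rate \<rho> (noisy_channel g h \<Phi>) \<partial>(phase_noise_measure \<sigma>2))"

end

theory Submission
  imports Defs
begin

text \<open>
  The phases of \<open>g\<close> and \<open>h\<close> cancel in the determinant, and by Sylvester's identity and
  transposition both cases reduce to \<open>det (I + c N\<^sup>H N)\<close>, where \<open>N = 1 + \<i> \<Phi>\<close> has at most as many
  rows (\<open>n\<close>) as columns (\<open>m\<close>). An orthogonal rotation of the rows preserves the law of \<open>\<Phi>\<close> and
  concentrates the all-ones matrix in one row, of mean \<open>sqrt n\<close>. Adding the rows one at a time, with
  this one first, multiplies the determinant by \<open>1 + c v M\<^sup>-\<^sup>1 v\<^sup>H\<close>. For a purely imaginary Gaussian row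
  \<open>v = \<i> y\<close> the new term is \<open>y\<^sup>T Q y\<close> with \<open>Q = Re M\<^sup>-\<^sup>1\<close>, \<open>0 \<le> Q \<le> 1\<close>, and \<open>trace Q \<ge> m - k\<close> after \<open>k\<close> rows.

  Diagonalizing \<open>Q\<close>, Bernoulli's inequality \<open>(1 + y) powr l \<le> 1 + l y\<close> bounds the Laplace transform of
  \<open>y\<^sup>T Q y\<close> by that of \<open>\<sigma>\<^sup>2\<close> times a chi-square variable with \<open>m - k\<close> degrees of freedom, hence also its
  moments of small negative order \<open>-s\<close>. A tangent to the convex function \<open>x \<mapsto> ln (A + c exp x)\<close> combined with
  \<open>ln x \<ge> (1 - x powr -s) / s\<close> turns these moments into the desired bound as \<open>s \<rightarrow> 0\<close>; the digamma function
  appears as the logarithmic derivative of the Gamma function.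
\<close>

section \<open>Sylvester's determinant identity\<close>

definition block_mat ::
  "'a^'n^'n \<Rightarrow> 'a^'m^'n \<Rightarrow> 'a^'n^'m \<Rightarrow> 'a^'m^'m \<Rightarrow> 'a^('n + 'm)^('n + 'm)" where
  "block_mat A B C D = (\<chi> i j.
     case i of Inl a \<Rightarrow> (case j of Inl b \<Rightarrow> A $ a $ b | Inr b \<Rightarrow> B $ a $ b)
             | Inr a \<Rightarrow> (case j of Inl b \<Rightarrow> C $ a $ b | Inr b \<Rightarrow> D $ a $ b))"

lemma block_mat_nth [simp]:
  "block_mat A B C D $ Inl a $ Inl b = A $ a $ b"
  "block_mat A B C D $ Inl a $ Inr d = B $ a $ d"
  "block_mat A B C D $ Inr c $ Inl b = C $ c $ b"
  "block_mat A B C D $ Inr c $ Inr d = D $ c $ d"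
  by (simp_all add: block_mat_def)

lemma sum_UNIV_sum:
  fixes f :: "'n::finite + 'm::finite \<Rightarrow> 'b::comm_monoid_add"
  shows "sum f UNIV = (\<Sum>a\<in>UNIV. f (Inl a)) + (\<Sum>b\<in>UNIV. f (Inr b))"
  by (simp add: sum.Plus o_def flip: UNIV_Plus_UNIV)

lemma block_mat_mult:
  fixes A A' :: "'a::semiring_1^'n::finite^'n" and D D' :: "'a^'m::finite^'m"
  shows "block_mat A B C D ** block_mat A' B' C' D' =
    block_mat (A ** A' + B ** C') (A ** B' + B ** D') (C ** A' + D ** C') (C ** B' + D ** D')"
proof -
  have "(block_mat A B C D ** block_mat A' B' C' D') $ i $ j =
    block_mat (A ** A' + B ** C') (A ** B' + B ** D') (C ** A' + D ** C') (C ** B' + D ** D') $ i $ j" for i j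
    by (cases i; cases j) (simp_all add: matrix_matrix_mult_def sum_UNIV_sum)
  then show ?thesis by (simp add: vec_eq_iff)
qed


text \<open>In the Leibniz expansion a permutation contributes only if it fixes every index outside
  \<open>range f\<close>. These permutations are exactly the transports along \<open>f\<close> of
  permutations of the small index type, with equal sign and product. An arbitrary injection
  \<open>f\<close> covers both block positions, \<open>Inl\<close> and \<open>Inr\<close>.\<close>

lemma det_extend_by_identity:
  fixes A :: "'a::comm_ring_1^'n^'n" and P :: "'a^'k^'k" and f :: "'n::finite \<Rightarrow> 'k::finite"
  assumes f: "inj f" and PA: "\<And>a b. P $ f a $ f b = A $ a $ b"
    and P1: "\<And>i j. i \<notin> range f \<or> j \<notin> range f \<Longrightarrow> P $ i $ j = (if i = j then 1 else 0)"
  shows "det P = det A"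
proof -
  let ?t = "\<lambda>p. of_int (sign p) * (\<Prod>i\<in>UNIV. P $ i $ p i)"
  let ?e = "map_permutation UNIV f"
  have bij: "bij_betw f UNIV (range f)"
    using f by (simp add: inj_on_imp_bij_betw)
  have perm: "?e q permutes range f" if "q permutes UNIV" for q
    using map_permutation_permutes[OF bij that] .
  have app: "?e q (f a) = f (q a)" for q a
    using f by (simp add: map_permutation_apply)
  have sgn: "sign (?e q) = sign q" if "q permutes UNIV" for q
    using f that by (simp add: sign_map_permutation)
  have zero: "?t p = 0" if p: "p permutes UNIV" and ne: "p \<notin> ?e ` {q. q permutes UNIV}" for p
  proof -
    have "\<exists>i. P $ i $ p i = 0"
    proof (rule ccontr)
      assume "\<not> ?thesis"
      then have fixes_out: "p i = i" if "i \<notin> range f" for i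
        using P1[of i "p i"] that by (auto split: if_splits)
      then have pr: "p permutes range f"
        using p by (auto simp: permutes_def)
      have bij': "bij_betw (inv f) (range f) UNIV"
        using bij f by (simp add: bij_betw_inv_into)
      let ?q = "map_permutation (range f) (inv f) p"
      have "?e ?q = p"
        by (rule map_permutation_compose_inv[OF bij' pr]) (auto simp: f)
      moreover have "?q permutes UNIV"
        using map_permutation_permutes[OF bij' pr] .
      ultimately show False using ne by (metis image_eqI mem_Collect_eq)
    qed
    then have "(\<Prod>i\<in>UNIV. P $ i $ p i) = 0"
      by (intro prod_zero) auto
    then show ?thesis by simp
  qed
  have inj_e: "inj_on ?e {q. q permutes UNIV}"
    by (rule inj_onI) (metis app f injD ext)
  have val: "?t (?e q) = of_int (sign q) * (\<Prod>a\<in>UNIV. A $ a $ q a)" if q: "q permutes UNIV" for q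
  proof -
    have "(\<Prod>i\<in>UNIV. P $ i $ ?e q i) = (\<Prod>i\<in>range f. P $ i $ ?e q i)"
      by (rule prod.mono_neutral_right) (use P1 permutes_not_in[OF perm[OF q]] in auto)
    also have "\<dots> = (\<Prod>a\<in>UNIV. A $ a $ q a)"
      using f by (simp add: prod.reindex app PA)
    finally show ?thesis using sgn[OF q] by simp
  qed
  have "det P = sum ?t {p. p permutes UNIV}"
    by (simp add: det_def)
  also have "\<dots> = sum ?t (?e ` {q. q permutes UNIV})"
    by (rule sum.mono_neutral_right)
       (use zero in \<open>auto simp: finite_permutations intro: permutes_subset[OF perm]\<close>)
  also have "\<dots> = det A"
    using inj_e by (simp add: sum.reindex det_def val)
  finally show ?thesis .
qed

lemma det_block_diag_left:
  fixes A :: "'a::comm_ring_1^'n::finite^'n"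
  shows "det (block_mat A 0 0 (mat 1 :: 'a^'m::finite^'m)) = det A"
proof (rule det_extend_by_identity[where f = Inl])
  fix i j :: "'n + 'm"
  assume "i \<notin> range Inl \<or> j \<notin> range Inl"
  then show "block_mat A 0 0 (mat 1) $ i $ j = (if i = j then 1 else 0)"
    by (cases i; cases j) (auto simp: mat_def)
qed auto

lemma det_block_diag_right:
  fixes A :: "'a::comm_ring_1^'n::finite^'n"
  shows "det (block_mat (mat 1 :: 'a^'m::finite^'m) 0 0 A) = det A"
proof (rule det_extend_by_identity[where f = Inr])
  fix i j :: "'m + 'n"
  assume "i \<notin> range Inr \<or> j \<notin> range Inr"
  then show "block_mat (mat 1) 0 0 A $ i $ j = (if i = j then 1 else 0)"
    by (cases i; cases j) (auto simp: mat_def)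
qed auto

lemma mat_1_block: "(mat 1 :: 'a::semiring_1^('n::finite+'m::finite)^('n+'m)) = block_mat (mat 1) 0 0 (mat 1)"
proof -
  have "(mat 1 :: 'a^('n+'m)^('n+'m)) $ i $ j = block_mat (mat 1) 0 0 (mat 1) $ i $ j" for i j
    by (cases i; cases j) (simp_all add: mat_def)
  then show ?thesis by (simp add: vec_eq_iff)
qed

lemma matrix_mul_zero [simp]:
  fixes A :: "'a::semiring_1^'m::finite^'n::finite"
  shows "A ** (0 :: 'a^'k::finite^'m) = 0" and "(0 :: 'a^'n^'k::finite) ** A = 0"
  by (simp_all add: matrix_matrix_mult_def vec_eq_iff)

lemma matrix_mul_uminus [simp]:
  fixes A :: "'a::ring_1^'m::finite^'n::finite" and B :: "'a^'k::finite^'m"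
  shows "A ** - B = - (A ** B)" and "- A ** B = - (A ** B)"
  by (simp_all add: matrix_matrix_mult_def vec_eq_iff sum_negf)

text \<open>Multiplying \<open>?P\<close> by the unipotent matrix \<open>?E X\<close> eliminates its
  block \<open>- X\<close>: from the left this leaves \<open>mat 1 + X ** Y\<close>, from the right
  \<open>mat 1 + Y ** X\<close>, in both cases times \<open>?F Y\<close>. The two products have the
  same determinant.\<close>

theorem sylvester_determinant:
  fixes X :: "'a::comm_ring_1^'m::finite^'n::finite" and Y :: "'a^'n^'m"
  shows "det (mat 1 + X ** Y) = det (mat 1 + Y ** X)"
proof -
  let ?E = "\<lambda>Z :: 'a^'m^'n. block_mat (mat 1) Z 0 (mat 1)"
  let ?F = "\<lambda>Z :: 'a^'n^'m. block_mat (mat 1) 0 Z (mat 1)"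
  let ?P = "block_mat (mat 1) (- X) Y (mat 1)"
  have 1: "?E X ** ?P = block_mat (mat 1 + X ** Y) 0 0 (mat 1) ** ?F Y"
    by (simp add: block_mat_mult)
  have 2: "?P ** ?E X = ?F Y ** block_mat (mat 1) 0 0 (mat 1 + Y ** X)"
    by (simp add: block_mat_mult add.commute)
  have "det (?E X) * det ?P = det (mat 1 + X ** Y) * det (?F Y)"
    using arg_cong[OF 1, of det] by (simp add: det_mul det_block_diag_left)
  moreover have "det ?P * det (?E X) = det (?F Y) * det (mat 1 + Y ** X)"
    using arg_cong[OF 2, of det] by (simp add: det_mul det_block_diag_right)
  ultimately have eq: "det (?F Y) * det (mat 1 + X ** Y) = det (?F Y) * det (mat 1 + Y ** X)"
    by (simp add: mult.commute)
  \<comment> \<open>Over a commutative ring the common factor \<open>det (?F Y)\<close> can be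
    cancelled because it is a unit, \<open>?F (- Y)\<close> being an inverse of
    \<open>?F Y\<close>.\<close>
  have "?F (- Y) ** ?F Y = mat 1"
    by (simp add: block_mat_mult mat_1_block)
  then have unit: "det (?F (- Y)) * det (?F Y) = 1"
    by (metis det_mul det_I)
  show ?thesis
    using arg_cong[OF eq, of "(*) (det (?F (- Y)))"] unit by (simp flip: mult.assoc)
qed

section \<open>Diagonalization of real symmetric matrices\<close>

text \<open>A maximizer \<open>b\<close> of the Rayleigh quotient on the compact unit sphere of
  \<open>S\<close> works: its residual \<open>w = f b - \<mu> *\<^sub>R b\<close> lies in
  \<open>S\<close> by invariance, and if it were nonzero, a small move along \<open>w\<close> would
  increase the quotient.\<close>

lemma self_adjoint_eigenvector:
  fixes f :: "'a::euclidean_space \<Rightarrow> 'a"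
  assumes f: "linear f" and sa: "\<And>x y. x \<bullet> f y = f x \<bullet> y"
    and S: "subspace S" "f ` S \<subseteq> S" and ne: "S \<noteq> {0}"
  obtains b \<mu> where "b \<in> S" "norm b = 1" "f b = \<mu> *\<^sub>R b"
proof -
  have "bounded_linear f"
    using f by (simp add: linear_conv_bounded_linear)
  then have cont: "continuous_on T (\<lambda>x. x \<bullet> f x)" for T
    by (intro continuous_on_inner continuous_on_id linear_continuous_on)
  obtain z where z: "z \<in> S" "z \<noteq> 0"
    using ne subspace_0[OF S(1)] by auto
  have "sgn z \<in> sphere 0 1 \<inter> S"
    using z S(1) by (simp add: sgn_div_norm subspace_mul)
  moreover have "compact (sphere 0 1 \<inter> S)"
    by (simp add: S(1) closed_subspace compact_Int_closed)
  ultimately obtain b where b: "b \<in> sphere 0 1 \<inter> S"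
    and max: "\<And>y. y \<in> sphere 0 1 \<inter> S \<Longrightarrow> y \<bullet> f y \<le> b \<bullet> f b"
    using continuous_attains_sup[OF _ _ cont] by (metis empty_iff)
  define \<mu> where "\<mu> = b \<bullet> f b"
  have bS: "b \<in> S" and nb: "norm b = 1" using b by auto
  have bb: "b \<bullet> b = 1" using nb by (simp add: dot_square_norm)
  have le: "y \<bullet> f y \<le> \<mu> * (y \<bullet> y)" if y: "y \<in> S" for y
  proof (cases "y = 0")
    case False
    have "sgn y \<bullet> f (sgn y) \<le> \<mu>"
      unfolding \<mu>_def using y S(1) False by (intro max) (auto simp: sgn_div_norm subspace_mul)
    moreover have "sgn y \<bullet> f (sgn y) = (y \<bullet> f y) / (y \<bullet> y)"
      by (simp add: sgn_div_norm linear_cmul[OF f] dot_square_norm power2_eq_square divide_simps)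
    ultimately show ?thesis using False by (simp add: divide_le_eq)
  qed (simp add: linear_0[OF f])
  define w where "w = f b - \<mu> *\<^sub>R b"
  have wS: "w \<in> S"
    unfolding w_def using S bS by (auto intro!: subspace_diff subspace_mul)
  \<comment> \<open>first variation of the Rayleigh quotient in the direction of the residual\<close>
  have ineq: "2 * t * (w \<bullet> w) \<le> t\<^sup>2 * (\<mu> * (w \<bullet> w) - w \<bullet> f w)" for t
  proof -
    have "b + t *\<^sub>R w \<in> S" using bS wS S(1) by (simp add: subspace_add subspace_mul)
    from le[OF this] have "(b + t *\<^sub>R w) \<bullet> (f b + t *\<^sub>R f w) \<le>
        \<mu> * ((b + t *\<^sub>R w) \<bullet> (b + t *\<^sub>R w))"
      by (simp add: linear_add[OF f] linear_cmul[OF f])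
    moreover have "b \<bullet> f w = w \<bullet> f b" using sa[of b w] by (simp add: inner_commute)
    moreover have "w \<bullet> f b = w \<bullet> w + \<mu> * (b \<bullet> w)"
    proof -
      have "w \<bullet> f b = w \<bullet> (w + \<mu> *\<^sub>R b)" by (simp add: w_def)
      then show ?thesis by (simp add: inner_add_right inner_commute)
    qed
    ultimately show ?thesis
      using bb \<mu>_def by (simp add: inner_add_left inner_add_right inner_commute
          power2_eq_square algebra_simps)
  qed
  have "w \<bullet> w = 0"
  proof (rule ccontr)
    assume "w \<bullet> w \<noteq> 0"
    then have pos: "w \<bullet> w > 0" by simp
    define K where "K = \<mu> * (w \<bullet> w) - w \<bullet> f w"
    \<comment> \<open>The size of \<open>t\<close> makes the second-order term at most
      \<open>t * (w \<bullet> w)\<close>, half of the first-order gain; the summand 1 avoids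
      division by zero.\<close>
    define t where "t = (w \<bullet> w) / (\<bar>K\<bar> + 1)"
    have t: "t > 0" using pos by (simp add: t_def)
    have "2 * t * (w \<bullet> w) \<le> t * (t * K)"
      using ineq[of t] by (simp add: K_def power2_eq_square mult.assoc)
    then have "2 * (w \<bullet> w) \<le> t * K" using t by (simp add: mult.assoc)
    also have "\<dots> \<le> t * (\<bar>K\<bar> + 1)" using t by (intro mult_left_mono) auto
    also have "\<dots> = w \<bullet> w" by (simp add: t_def)
    finally show False using pos by simp
  qed
  then have "f b = \<mu> *\<^sub>R b" by (simp add: w_def)
  then show thesis using that bS nb by blast
qed

text \<open>Induction on the dimension: split off one unit eigenvector \<open>b\<close>;
  self-adjointness makes the orthogonal complement of \<open>b\<close> in \<open>S\<close> invariant
  again.\<close>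

lemma self_adjoint_eigenbasis:
  fixes f :: "'a::euclidean_space \<Rightarrow> 'a"
  assumes f: "linear f" and sa: "\<And>x y. x \<bullet> f y = f x \<bullet> y"
    and S: "subspace S" "f ` S \<subseteq> S"
  shows "\<exists>B. B \<subseteq> S \<and> pairwise orthogonal B \<and> (\<forall>b\<in>B. norm b = 1 \<and> (\<exists>\<mu>. f b = \<mu> *\<^sub>R b)) \<and> span B = S"
  using S
proof (induction "dim S" arbitrary: S rule: less_induct)
  case less
  show ?case
  proof (cases "S = {0}")
    case True
    then show ?thesis by (intro exI[of _ "{}"]) auto
  next
    case False
    obtain b \<mu> where b: "b \<in> S" "norm b = 1" "f b = \<mu> *\<^sub>R b"
      using self_adjoint_eigenvector[OF f sa less.prems False] .
    define T where "T = {y \<in> S. b \<bullet> y = 0}"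
    have T: "subspace T"
      using less.prems(1) by (auto simp: T_def subspace_def inner_right_distrib)
    have fT: "f ` T \<subseteq> T"
      using less.prems(2) b(3) by (auto simp: T_def sa)
    have "b \<notin> T" using b(2) by (auto simp: T_def)
    then have "T \<subset> S" using b(1) unfolding T_def by blast
    then have "dim T < dim S"
      using T less.prems(1) by (simp add: dim_psubset span_eq_iff[THEN iffD2])
    then obtain B where B: "B \<subseteq> T" "pairwise orthogonal B"
      "\<forall>b\<in>B. norm b = 1 \<and> (\<exists>\<mu>. f b = \<mu> *\<^sub>R b)" "span B = T"
      using less.hyps T fT by blast
    have "span (insert b B) = S"
    proof
      show "span (insert b B) \<subseteq> S"
        using b(1) B(1) less.prems(1) by (intro span_minimal) (auto simp: T_def)
      show "S \<subseteq> span (insert b B)"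
      proof
        fix y assume y: "y \<in> S"
        have "y - (b \<bullet> y) *\<^sub>R b \<in> T"
          using y b less.prems(1)
          by (auto simp: T_def inner_diff_right dot_square_norm subspace_diff subspace_mul)
        then show "y \<in> span (insert b B)"
          using B(4) by (auto simp: span_insert)
      qed
    qed
    moreover have "pairwise orthogonal (insert b B)"
      using B(1,2) by (auto simp: pairwise_insert T_def orthogonal_def inner_commute)
    ultimately show ?thesis
      using B b by (intro exI[of _ "insert b B"]) (auto simp: T_def)
  qed
qed

theorem real_symmetric_diagonalization:
  fixes Q :: "real^'m::finite^'m"
  assumes sym: "transpose Q = Q"
  shows "\<exists>U l. orthogonal_matrix U \<and> (\<forall>i. Q *v row i U = l i *\<^sub>R row i U)"
proof -
  have sa: "x \<bullet> (Q *v y) = (Q *v x) \<bullet> y" for x y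
    by (metis sym dot_lmul_matrix matrix_vector_mul(1) transpose_matrix_vector)
  obtain B where B: "pairwise orthogonal B" "\<And>b. b \<in> B \<Longrightarrow> norm b = 1"
    "\<And>b. b \<in> B \<Longrightarrow> \<exists>\<mu>. Q *v b = \<mu> *\<^sub>R b" "span B = UNIV"
    using self_adjoint_eigenbasis[of "(*v) Q" UNIV] sa by auto
  have ind: "independent B"
    using B(1,2) by (intro pairwise_orthogonal_independent) (auto dest: B(2)[of 0])
  then have "card B = CARD('m)" "finite B"
    using B(4) by (metis dim_UNIV dim_span dim_eq_card_independent DIM_cart DIM_real mult.right_neutral, simp add: independent_imp_finite)
  then obtain e :: "'m \<Rightarrow> real^'m" where e: "bij_betw e UNIV B"
    by (metis finite_same_card_bij finite)
  define U :: "real^'m^'m" where "U = (\<chi> i. e i)"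
  have row: "row i U = e i" for i by (simp add: U_def row_def vec_eq_iff)
  have eB: "e i \<in> B" for i using e by (auto simp: bij_betw_def)
  have "orthogonal_matrix U"
    unfolding orthogonal_matrix_orthonormal_rows row
  proof (intro conjI allI impI)
    fix i j :: 'm
    assume "i \<noteq> j"
    then have "e i \<noteq> e j" using e by (auto simp: bij_betw_def inj_on_def)
    then show "orthogonal (e i) (e j)" using B(1) eB by (auto simp: pairwise_def)
  qed (use B(2) eB in auto)
  moreover have "\<forall>i. \<exists>\<mu>. Q *v e i = \<mu> *\<^sub>R e i"
    using B(3) eB by blast
  then have "\<exists>l. \<forall>i. Q *v e i = l i *\<^sub>R e i"
    by (rule choice)
  ultimately show ?thesis by (intro exI[of _ U]) (simp add: row)
qed

section \<open>Products of Gaussian measures\<close>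

text \<open>Bridge between product measures on functions, where the noise lives, and Lebesgue
  measure on vectors, where orthogonal maps act. Agreement on boxes suffices.\<close>

lemma lborel_cart_eq_distr_PiM:
  "(lborel :: (real^'k::finite) measure) = distr (PiM UNIV (\<lambda>_. lborel)) borel (\<lambda>x. \<chi> i. x i)"
proof (rule lborel_eqI)
  interpret product_sigma_finite "\<lambda>_::'k. lborel :: real measure" ..
  have [measurable]: "(\<lambda>x. \<chi> i. x i) \<in> (\<Pi>\<^sub>M i\<in>(UNIV::'k set). lborel) \<rightarrow>\<^sub>M (borel :: (real^'k) measure)"
    by (subst borel_measurable_euclidean_space) (auto simp: Basis_vec_def inner_axis)
  fix l u :: "real^'k"
  assume "\<And>b. b \<in> Basis \<Longrightarrow> l \<bullet> b \<le> u \<bullet> b"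
  then have le: "l $ i \<le> u $ i" for i
    by (metis axis_in_Basis_iff cart_eq_inner_axis Basis_real_def insertI1)
  have "(\<lambda>x. \<chi> i. x i) -` box l u \<inter> space (\<Pi>\<^sub>M i\<in>(UNIV::'k set). lborel) = Pi\<^sub>E UNIV (\<lambda>i. {l $ i<..<u $ i})"
    by (auto simp: mem_box_cart space_PiM PiE_def Pi_def)
  moreover have "(\<Prod>b\<in>Basis. (u - l) \<bullet> b) = (\<Prod>i\<in>UNIV. (u - l) $ i)"
  proof -
    have basis: "Basis = range (\<lambda>i::'k. axis i (1::real))"
      by (auto simp: Basis_vec_def)
    have inj: "inj (\<lambda>i::'k. axis i (1::real))"
      by (auto simp: inj_def axis_eq_axis)
    show ?thesis
      unfolding basis prod.reindex[OF inj] by (simp add: inner_axis)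
  qed
  ultimately show "emeasure (distr (PiM UNIV (\<lambda>_. lborel)) borel (\<lambda>x. \<chi> i. x i)) (box l u)
      = (\<Prod>b\<in>Basis. (u - l) \<bullet> b)"
    using le by (simp add: emeasure_distr emeasure_PiM prod_ennreal)
qed simp

lemma nn_integral_lborel_translate:
  fixes f :: "'a::euclidean_space \<Rightarrow> ennreal"
  assumes [measurable]: "f \<in> borel_measurable borel"
  shows "(\<integral>\<^sup>+x. f (c + x) \<partial>lborel) = (\<integral>\<^sup>+x. f x \<partial>lborel)"
  by (subst (2) lborel_distr_plus[of c, symmetric]) (simp add: nn_integral_distr)

text \<open>Both measures are translation invariant, so, as in the proof of uniqueness of Haar measure, they
  are proportional; the factor is 1 because the unit ball is invariant.\<close>

lemma lborel_distr_orthogonal: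
  fixes T :: "'a::euclidean_space \<Rightarrow> 'a"
  assumes T: "orthogonal_transformation T"
  shows "distr lborel borel T = lborel"
proof (rule measure_eqI)
  have lin: "linear T" using T by (rule orthogonal_transformation_linear)
  then have Tm[measurable]: "T \<in> borel_measurable borel"
    by (intro borel_measurable_continuous_onI linear_continuous_on) (simp add: linear_conv_bounded_linear)
  have TS: "T (inv T y) = y" for y
    using orthogonal_transformation_surj[OF T] by (rule surj_f_inv_f)
  have "linear (inv T)"
    using orthogonal_transformation_inv[OF T] by (rule orthogonal_transformation_linear)
  then have [measurable]: "inv T \<in> borel_measurable borel"
    by (intro borel_measurable_continuous_onI linear_continuous_on) (simp add: linear_conv_bounded_linear)
  fix A assume "A \<in> sets (distr lborel borel T)"
  then have A[measurable]: "A \<in> sets borel" by simp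
  let ?G = "indicator (ball 0 1) :: 'a \<Rightarrow> ennreal"
  let ?F = "indicator A :: 'a \<Rightarrow> ennreal"
  let ?C = "emeasure lborel (ball (0::'a) 1)"
  have [measurable]: "?G \<in> borel_measurable borel"
    by (intro borel_measurable_indicator) simp
  have "?C * emeasure (distr lborel borel T) A = (\<integral>\<^sup>+y. ?G y * (\<integral>\<^sup>+x. ?F (T x) \<partial>lborel) \<partial>lborel)"
  proof -
    have "emeasure (distr lborel borel T) A = (\<integral>\<^sup>+x. ?F x \<partial>distr lborel borel T)" by simp
    also have "\<dots> = (\<integral>\<^sup>+x. ?F (T x) \<partial>lborel)"
      by (rule nn_integral_distr) auto
    finally show ?thesis by (subst nn_integral_multc) auto
  qed
  also have "\<dots> = (\<integral>\<^sup>+y. ?G y * (\<integral>\<^sup>+x. ?F (y + T x) \<partial>lborel) \<partial>lborel)"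
  proof -
    have "(\<integral>\<^sup>+x. ?F (T x) \<partial>lborel) = (\<integral>\<^sup>+x. ?F (y + T x) \<partial>lborel)" for y
      using nn_integral_lborel_translate[of "\<lambda>x. ?F (T x)" "inv T y"] by (simp add: linear_add[OF lin] TS)
    then show ?thesis by simp
  qed
  also have "\<dots> = (\<integral>\<^sup>+y. (\<integral>\<^sup>+x. ?G y * ?F (y + T x) \<partial>lborel) \<partial>lborel)"
    by (simp add: nn_integral_cmult)
  also have "\<dots> = (\<integral>\<^sup>+x. (\<integral>\<^sup>+y. ?G y * ?F (y + T x) \<partial>lborel) \<partial>lborel)"
    by (rule lborel_pair.Fubini') measurable
  also have "\<dots> = (\<integral>\<^sup>+x. (\<integral>\<^sup>+y. ?G (y - T x) * ?F y \<partial>lborel) \<partial>lborel)"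
  proof -
    have "(\<integral>\<^sup>+y. ?G y * ?F (y + T x) \<partial>lborel) = (\<integral>\<^sup>+y. ?G (y - T x) * ?F y \<partial>lborel)" for x
      using nn_integral_lborel_translate[of "\<lambda>y. ?G (y - T x) * ?F y" "T x"] by (simp add: add.commute)
    then show ?thesis by simp
  qed
  also have "\<dots> = (\<integral>\<^sup>+y. (\<integral>\<^sup>+x. ?G (y - T x) * ?F y \<partial>lborel) \<partial>lborel)"
    by (rule lborel_pair.Fubini') measurable
  also have "\<dots> = (\<integral>\<^sup>+y. ?C * ?F y \<partial>lborel)"
  proof (rule nn_integral_cong)
    fix y
    \<comment> \<open>Since \<open>T\<close> is an isometry, the inner integral is the volume of the
      unit ball centred at \<open>inv T y\<close>, hence independent of \<open>y\<close>.\<close>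
    have "norm (y - T x) = norm (- inv T y + x)" for x
    proof -
      have "y - T x = T (inv T y - x)" by (simp add: linear_diff[OF lin] TS)
      then show ?thesis
        by (simp add: orthogonal_transformation_norm[OF T] norm_minus_commute)
    qed
    then have "(\<integral>\<^sup>+x. ?G (y - T x) \<partial>lborel) = (\<integral>\<^sup>+x. ?G (- inv T y + x) \<partial>lborel)"
      by (intro nn_integral_cong) (simp add: indicator_def)
    also have "\<dots> = (\<integral>\<^sup>+x. ?G x \<partial>lborel)"
      by (rule nn_integral_lborel_translate) measurable
    finally show "(\<integral>\<^sup>+x. ?G (y - T x) * ?F y \<partial>lborel) = ?C * ?F y"
      by (simp add: nn_integral_multc)
  qed
  also have "\<dots> = ?C * emeasure lborel A"
    by (simp add: nn_integral_cmult)
  finally have "?C * emeasure (distr lborel borel T) A = ?C * emeasure lborel A" .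
  moreover have "?C \<noteq> 0"
    using content_ball_pos[of 1 "0::'a"] by (auto simp: measure_def)
  moreover have "?C < \<top>"
    using emeasure_lborel_ball_finite[of "0::'a" 1] by (simp add: less_top)
  ultimately show "emeasure (distr lborel borel T) A = emeasure lborel A"
    by (auto simp: ennreal_mult_cancel_left)
qed simp

lemma PiM_density_lborel:
  fixes f :: "real \<Rightarrow> real"
  assumes [measurable]: "f \<in> borel_measurable borel" and nn: "\<And>x. 0 \<le> f x"
    and sf: "sigma_finite_measure (density lborel f)"
  shows "PiM UNIV (\<lambda>_::'k::finite. density lborel f) =
    density (PiM UNIV (\<lambda>_. lborel)) (\<lambda>x. \<Prod>i\<in>UNIV. f (x i))"
proof -
  interpret L: product_sigma_finite "\<lambda>_::'k. lborel :: real measure" ..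
  interpret D: product_sigma_finite "\<lambda>_::'k. density lborel f"
    using sf by (simp add: product_sigma_finite_def)
  let ?P = "density (PiM UNIV (\<lambda>_::'k. lborel :: real measure)) (\<lambda>x. ennreal (\<Prod>i\<in>UNIV. f (x i)))"
  have "?P = PiM UNIV (\<lambda>_. density lborel f)"
  proof (rule D.PiM_eqI)
    show "sets ?P = sets (PiM UNIV (\<lambda>_. density lborel f))"
      by (simp cong: sets_PiM_cong)
    fix A :: "'k \<Rightarrow> real set"
    assume A: "\<And>i. i \<in> UNIV \<Longrightarrow> A i \<in> sets (density lborel f)"
    then have [measurable]: "A i \<in> sets borel" for i by simp
    have [measurable]: "Pi\<^sub>E UNIV A \<in> sets (PiM UNIV (\<lambda>_. lborel))"
      by (rule sets_PiM_I_finite) auto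
    have "emeasure ?P (Pi\<^sub>E UNIV A) =
      (\<integral>\<^sup>+x. (\<Prod>i\<in>UNIV. ennreal (f (x i)) * indicator (A i) (x i)) \<partial>PiM UNIV (\<lambda>_. lborel))"
    proof (subst emeasure_density)
      show "(\<integral>\<^sup>+x. ennreal (\<Prod>i\<in>UNIV. f (x i)) * indicator (Pi\<^sub>E UNIV A) x \<partial>PiM UNIV (\<lambda>_. lborel)) =
        (\<integral>\<^sup>+x. (\<Prod>i\<in>UNIV. ennreal (f (x i)) * indicator (A i) (x i)) \<partial>PiM UNIV (\<lambda>_. lborel))"
        by (auto intro!: nn_integral_cong
            simp: prod.distrib prod_ennreal nn indicator_def PiE_def Pi_def)
    qed measurable
    also have "\<dots> = (\<Prod>i\<in>UNIV. \<integral>\<^sup>+y. ennreal (f y) * indicator (A i) y \<partial>lborel)"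
      by (rule L.product_nn_integral_prod) auto
    also have "\<dots> = (\<Prod>i\<in>UNIV. emeasure (density lborel f) (A i))"
      by (simp add: emeasure_density)
    finally show "emeasure ?P (Pi\<^sub>E UNIV A) = (\<Prod>i\<in>UNIV. emeasure (density lborel f) (A i))" .
  qed simp
  then show ?thesis ..
qed

abbreviation gaussian :: "real \<Rightarrow> real measure" where
  "gaussian s \<equiv> density lborel (normal_density 0 s)"

lemma sets_PiM_borel_cong: "sets (PiM I (\<lambda>_. gaussian s)) = sets (PiM I (\<lambda>_. borel))"
  by (intro sets_PiM_cong) auto

text \<open>The joint density of independent centred Gaussians of equal variance depends only on the
  Euclidean norm, and Lebesgue measure is rotation invariant. With nonnegative integrals the
  invariance applies to every measurable \<open>f\<close>, with no question of
  integrability.\<close>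

lemma nn_integral_PiM_gaussian_orthogonal:
  fixes U :: "real^'k::finite^'k"
  assumes s: "s > 0" and U: "orthogonal_matrix U"
    and f[measurable]: "f \<in> borel_measurable (PiM UNIV (\<lambda>_. borel))"
  shows "(\<integral>\<^sup>+x. f (\<lambda>i. \<Sum>j\<in>UNIV. U $ i $ j * x j) \<partial>PiM UNIV (\<lambda>_::'k. gaussian s)) =
    (\<integral>\<^sup>+x. f x \<partial>PiM UNIV (\<lambda>_. gaussian s))"
proof -
  have [measurable]: "(\<lambda>x. \<chi> i. x i) \<in> (\<Pi>\<^sub>M i\<in>(UNIV::'k set). lborel) \<rightarrow>\<^sub>M (borel :: (real^'k) measure)"
    by (subst borel_measurable_euclidean_space) (auto simp: Basis_vec_def inner_axis)
  have [measurable]: "($) \<in> (borel :: (real^'k) measure) \<rightarrow>\<^sub>M (\<Pi>\<^sub>M i\<in>(UNIV::'k set). borel)"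
    by (rule measurable_PiM_single') auto
  have [measurable]: "f \<in> borel_measurable (PiM UNIV (\<lambda>_. lborel))"
    using f by (simp cong: measurable_cong_sets sets_PiM_cong)
  let ?n = "\<lambda>y::real^'k. (1 / sqrt (2 * pi * s\<^sup>2)) ^ CARD('k) * exp (- (norm y)\<^sup>2 / (2 * s\<^sup>2))"
  have dens: "(\<Prod>i\<in>UNIV. normal_density 0 s (y $ i)) = ?n y" for y :: "real^'k"
    by (simp add: normal_density_def prod_dividef power_divide norm_vec_def L2_set_def
        sum_nonneg sum_negf flip: exp_sum sum_divide_distrib)
  have key: "(\<integral>\<^sup>+x. g x \<partial>PiM UNIV (\<lambda>_. gaussian s)) = (\<integral>\<^sup>+y. ?n y * g (($) y) \<partial>lborel)"
    if [measurable]: "g \<in> borel_measurable (PiM UNIV (\<lambda>_. borel))" for g :: "('k \<Rightarrow> real) \<Rightarrow> ennreal"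
  proof -
    have [measurable]: "g \<in> borel_measurable (PiM UNIV (\<lambda>_. lborel))"
      using that by (simp cong: measurable_cong_sets sets_PiM_cong)
    have "(\<integral>\<^sup>+x. g x \<partial>PiM UNIV (\<lambda>_. gaussian s)) =
       (\<integral>\<^sup>+x. ennreal (\<Prod>i\<in>UNIV. normal_density 0 s (x i)) * g x \<partial>PiM UNIV (\<lambda>_. lborel))"
      by (subst PiM_density_lborel)
         (auto intro!: nn_integral_density prob_space_imp_sigma_finite prob_space_normal_density s)
    also have "\<dots> = (\<integral>\<^sup>+x. ennreal (?n (\<chi> i. x i)) * g (($) (\<chi> i. x i)) \<partial>PiM UNIV (\<lambda>_. lborel))"
      by (intro nn_integral_cong, subst dens[symmetric])
         (simp add: vec_lambda_inverse)
    also have "\<dots> = (\<integral>\<^sup>+y. ?n y * g (($) y) \<partial>lborel)"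
      by (subst lborel_cart_eq_distr_PiM, subst nn_integral_distr) auto
    finally show ?thesis .
  qed
  have T: "orthogonal_transformation ((*v) U)"
    using U by (simp add: orthogonal_transformation_matrix)
  then have [measurable]: "(*v) U \<in> borel_measurable borel"
    by (intro borel_measurable_continuous_onI linear_continuous_on)
       (simp add: linear_conv_bounded_linear orthogonal_transformation_linear)
  have [measurable]: "(\<lambda>x. f (\<lambda>i. \<Sum>j\<in>UNIV. U $ i $ j * x j)) \<in> borel_measurable (PiM UNIV (\<lambda>_. borel))"
    by (intro measurable_compose[OF _ f] measurable_PiM_single') auto
  have "(\<integral>\<^sup>+x. f x \<partial>PiM UNIV (\<lambda>_. gaussian s)) = (\<integral>\<^sup>+y. ?n y * f (($) y) \<partial>lborel)"
    by (rule key) auto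
  also have "\<dots> = (\<integral>\<^sup>+y. ?n y * f (($) y) \<partial>distr lborel borel ((*v) U))"
    by (simp add: lborel_distr_orthogonal[OF T])
  also have "\<dots> = (\<integral>\<^sup>+y. ?n (U *v y) * f (($) (U *v y)) \<partial>lborel)"
    by (subst nn_integral_distr) auto
  also have "\<dots> = (\<integral>\<^sup>+y. ?n y * f (\<lambda>i. \<Sum>j\<in>UNIV. U $ i $ j * y $ j) \<partial>lborel)"
  proof -
    have "($) (U *v y) = (\<lambda>i. \<Sum>j\<in>UNIV. U $ i $ j * y $ j)" for y
      by (simp add: fun_eq_iff matrix_vector_mult_def)
    then show ?thesis
      using orthogonal_transformation_norm[OF T] by simp
  qed
  also have "\<dots> = (\<integral>\<^sup>+x. f (\<lambda>i. \<Sum>j\<in>UNIV. U $ i $ j * x j) \<partial>PiM UNIV (\<lambda>_::'k. gaussian s))"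
    by (rule key[symmetric]) auto
  finally show ?thesis ..
qed

text \<open>Regroups a flat family of independent entries into independent rows. The bijection
  \<open>e\<close> is left free so that it can be the identity on index pairs or their swap, which
  transposes the noise matrix.\<close>

lemma distr_uncurry_PiM:
  fixes M :: "'a measure" and e :: "'k \<Rightarrow> 'n::finite \<times> 'm::finite"
  assumes "prob_space M" and e: "bij e"
  shows "distr (PiM UNIV (\<lambda>_::'n. PiM UNIV (\<lambda>_::'m. M))) (PiM UNIV (\<lambda>_. M)) (\<lambda>x k. x (fst (e k)) (snd (e k)))
    = PiM (UNIV :: 'k set) (\<lambda>_. M)"
proof -
  interpret M: prob_space M by fact
  interpret A: product_sigma_finite "\<lambda>_::'m. M"
    by (simp add: product_sigma_finite_def M.sigma_finite_measure_axioms)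
  interpret P: prob_space "PiM UNIV (\<lambda>_::'m. M)" by (rule prob_space_PiM) (simp add: assms)
  interpret B: product_sigma_finite "\<lambda>_::'n. PiM UNIV (\<lambda>_::'m. M)"
    by (simp add: product_sigma_finite_def P.sigma_finite_measure_axioms)
  interpret C: product_sigma_finite "\<lambda>_::'k. M"
    by (simp add: product_sigma_finite_def M.sigma_finite_measure_axioms)
  have fin: "finite (UNIV :: 'k set)"
    using e by (metis bij_betw_finite finite)
  have "(\<lambda>x. x i j) \<in> PiM UNIV (\<lambda>_::'n. PiM UNIV (\<lambda>_::'m. M)) \<rightarrow>\<^sub>M M" for i j
    by (rule measurable_compose[OF measurable_component_singleton[of i UNIV]
          measurable_component_singleton[of j UNIV]]) auto
  then have [measurable]: "(\<lambda>x k. x (fst (e k)) (snd (e k))) \<in>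
      PiM UNIV (\<lambda>_::'n. PiM UNIV (\<lambda>_::'m. M)) \<rightarrow>\<^sub>M PiM UNIV (\<lambda>_::'k. M)"
    by (rule measurable_PiM_single') (auto simp: space_PiM)
  show ?thesis
  proof (rule C.PiM_eqI[OF fin])
    fix A :: "'k \<Rightarrow> 'a set"
    assume A: "\<And>i. i \<in> UNIV \<Longrightarrow> A i \<in> sets M"
    let ?A = "\<lambda>i j. A (inv e (i, j))"
    have "(\<lambda>x k. x (fst (e k)) (snd (e k))) -` Pi\<^sub>E UNIV A \<inter> space (PiM UNIV (\<lambda>_::'n. PiM UNIV (\<lambda>_::'m. M)))
      = Pi\<^sub>E UNIV (\<lambda>i. Pi\<^sub>E UNIV (?A i))" (is "?l = ?r")
    proof
      show "?l \<subseteq> ?r"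
        using e by (auto simp: PiE_def Pi_def) (metis bij_inv_eq_iff fst_conv snd_conv)
      show "?r \<subseteq> ?l"
        using e A[THEN sets.sets_into_space] by (auto simp: PiE_def Pi_def space_PiM bij_is_inj subset_iff)
          (metis (no_types) bij_inv_eq_iff prod.collapse)+
    qed
    then have "emeasure (distr (PiM UNIV (\<lambda>_::'n. PiM UNIV (\<lambda>_::'m. M))) (PiM UNIV (\<lambda>_. M))
        (\<lambda>x k. x (fst (e k)) (snd (e k)))) (Pi\<^sub>E UNIV A) =
      (\<Prod>i\<in>UNIV. \<Prod>j\<in>UNIV. emeasure M (?A i j))"
      using A fin by (simp add: emeasure_distr sets_PiM_I_finite B.emeasure_PiM A.emeasure_PiM)
    also have "\<dots> = (\<Prod>p\<in>UNIV. emeasure M (A (inv e p)))"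
      by (simp add: prod.cartesian_product case_prod_unfold)
    also have "\<dots> = (\<Prod>k\<in>UNIV. emeasure M (A k))"
      by (rule prod.reindex_bij_betw) (rule bij_betw_inv_into, fact e)
    finally show "emeasure (distr (PiM UNIV (\<lambda>_::'n. PiM UNIV (\<lambda>_::'m. M))) (PiM UNIV (\<lambda>_. M))
        (\<lambda>x k. x (fst (e k)) (snd (e k)))) (Pi\<^sub>E UNIV A) = (\<Prod>k\<in>UNIV. emeasure M (A k))" .
  qed simp
qed

section \<open>From negative moments to logarithms\<close>

text \<open>For \<open>x > 0\<close> this is \<open>Gamma s\<close> times \<open>x powr -s\<close>,
  written as a Laplace integral so that moments of negative order reduce to Laplace transforms.
  Values in \<open>ennreal\<close> let it be infinite at 0, where \<open>powr\<close> would give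
  0.\<close>

definition gamma_kernel :: "real \<Rightarrow> real \<Rightarrow> ennreal" where
  "gamma_kernel s x = (\<integral>\<^sup>+u. ennreal (indicator {0..} u * u powr (s - 1) * exp (- (u * x))) \<partial>lborel)"

lemma gamma_kernel_measurable [measurable]: "gamma_kernel s \<in> borel_measurable borel"
  unfolding gamma_kernel_def by measurable

lemma gamma_kernel_eq:
  assumes s: "s > 0" and x: "x > 0"
  shows "gamma_kernel s x = ennreal (Gamma s / x powr s)"
proof -
  have "ennreal (Gamma s) = (\<integral>\<^sup>+t. ennreal (indicator {0..} t * t powr (s - 1) / exp t) \<partial>lborel)"
    by (rule Gamma_conv_nn_integral_real[OF s])
  also have "\<dots> = x * (\<integral>\<^sup>+u. ennreal (indicator {0..} (0 + x * u) * (0 + x * u) powr (s - 1) / exp (0 + x * u)) \<partial>lborel)"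
    using x by (subst nn_integral_real_affine[where c = x and t = 0]) auto
  also have "\<dots> = x * (\<integral>\<^sup>+u. ennreal (x powr (s - 1)) *
      ennreal (indicator {0..} u * u powr (s - 1) * exp (- (u * x))) \<partial>lborel)"
    using x by (intro arg_cong2[where f = "(*)"] nn_integral_cong refl)
      (auto simp: indicator_def powr_mult exp_minus field_simps zero_le_mult_iff simp flip: ennreal_mult)
  also have "\<dots> = ennreal (x * x powr (s - 1)) * gamma_kernel s x"
    using x by (simp add: nn_integral_cmult gamma_kernel_def mult.assoc ennreal_mult)
  also have "x * x powr (s - 1) = x powr s"
    using x by (simp add: powr_mult_base)
  finally have "ennreal (1 / x powr s) * ennreal (Gamma s) =
      ennreal (1 / x powr s) * (ennreal (x powr s) * gamma_kernel s x)"
    by simp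
  then show ?thesis
    using x s by (simp flip: mult.assoc ennreal_mult)
qed

text \<open>The kernel decreases in \<open>x\<close> and is unbounded near 0: a supposed finite
  value \<open>w\<close> at 0 is exceeded at the point \<open>x\<close> where the kernel equals
  \<open>w + 1\<close>.\<close>

lemma gamma_kernel_0:
  assumes s: "s > 0"
  shows "gamma_kernel s 0 = \<top>"
proof (rule ccontr)
  assume "gamma_kernel s 0 \<noteq> \<top>"
  then obtain w where w: "w \<ge> 0" "gamma_kernel s 0 = ennreal w"
    by (cases "gamma_kernel s 0") auto
  have "Gamma s > 0" using s by (rule Gamma_real_pos)
  then have G: "Gamma s > 0" "Gamma s \<noteq> 0" by linarith+
  define x where "x = (Gamma s / (w + 1)) powr (1 / s)"
  have x: "x > 0" "x powr s = Gamma s / (w + 1)"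
    using G w(1) s by (auto simp: x_def powr_powr)
  have "gamma_kernel s x \<le> gamma_kernel s 0"
    unfolding gamma_kernel_def using x
    by (intro nn_integral_mono ennreal_leI) (auto simp: indicator_def intro!: mult_left_le)
  then have "w + 1 \<le> w"
    using x G w s by (simp add: gamma_kernel_eq)
  then show False by simp
qed

text \<open>Concavity of \<open>ln\<close> between 1 and \<open>r\<close>, from
  \<open>ln t \<le> t - 1\<close> at both points divided by their weighted mean
  \<open>?y\<close>.\<close>

lemma weighted_ln_ge:
  fixes p r :: real
  assumes p: "0 \<le> p" "p \<le> 1" and r: "r > 0"
  shows "p * ln r \<le> ln (1 - p + p * r)"
proof -
  let ?y = "1 - p + p * r"
  have y: "?y > 0"
    using p r by (cases "p = 1") (auto intro!: add_pos_nonneg)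
  have "(1 - p) * ln (1 / ?y) + p * ln (r / ?y) \<le> (1 - p) * (1 / ?y - 1) + p * (r / ?y - 1)"
    using p r y by (intro add_mono mult_left_mono ln_le_minus_one) auto
  also have "\<dots> = 0"
    using y by (simp add: divide_simps) (simp add: algebra_simps)
  finally show ?thesis
    using y r by (simp add: ln_div algebra_simps)
qed

lemma one_plus_powr_le:
  fixes l y :: real
  assumes "0 \<le> l" "l \<le> 1" "y \<ge> 0"
  shows "(1 + y) powr l \<le> 1 + l * y"
proof -
  have "l * ln (1 + y) \<le> ln (1 + l * y)"
    using weighted_ln_ge[of l "1 + y"] assms by (simp add: algebra_simps)
  then have "exp (l * ln (1 + y)) \<le> exp (ln (1 + l * y))" by simp
  then show ?thesis using assms by (simp add: powr_def add_pos_nonneg)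
qed

text \<open>\<open>p\<close> is the slope at \<open>ln z0\<close> of the convex function
  \<open>x \<mapsto> ln (A + c * exp x)\<close>, so its tangent bounds \<open>ln (A + c * X)\<close>
  from below by a multiple of \<open>ln (X / z0)\<close>, which in turn is at least
  \<open>(1 - (X / z0) powr -s) / s\<close>. The negative power is moved to the right so that all
  terms stay nonnegative in \<open>ennreal\<close>.\<close>

lemma ln_tangent_gamma_kernel:
  fixes A c z0 s X :: real
  assumes A: "A \<ge> 1" and c: "c > 0" and z0: "z0 > 0" and s: "s > 0" and X: "X \<ge> 0"
  defines "p \<equiv> c * z0 / (A + c * z0)"
  shows "ennreal (ln (A + c * z0) + p / s) \<le>
    ennreal (ln (A + c * X)) + ennreal (p / s * z0 powr s / Gamma s) * gamma_kernel s X"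
proof (cases "X = 0")
  \<comment> \<open>Here \<open>ln (X / z0)\<close> makes no sense as a tangent argument, but the
    kernel makes the right side infinite.\<close>
  case True
  have "p > 0" using A c z0 by (simp add: p_def add_pos_pos)
  then have "p / s * z0 powr s / Gamma s > 0" using s z0 by (simp add: Gamma_real_pos)
  then have "ennreal (p / s * z0 powr s / Gamma s) \<noteq> 0"
    by (metis ennreal_eq_0_iff not_less)
  then have "ennreal (p / s * z0 powr s / Gamma s) * gamma_kernel s X = \<top>"
    using True gamma_kernel_0[OF s] by (simp only: ennreal_mult_top if_False)
  then show ?thesis by simp
next
  case False
  then have X: "X > 0" using X by simp
  have pos: "A + c * z0 > 0" "A + c * X > 0" using A c z0 X by (simp_all add: add_pos_pos)
  have p: "p > 0" "p \<le> 1" using A c z0 pos by (simp_all add: p_def add_pos_pos)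
  have "1 - p + p * (X / z0) = (A + c * X) / (A + c * z0)"
    using z0 pos by (simp add: p_def divide_simps)
  then have "p * ln (X / z0) \<le> ln (A + c * X) - ln (A + c * z0)"
    using weighted_ln_ge[of p "X / z0"] p X z0 pos by (simp add: ln_div)
  moreover have "p * ((1 - (X / z0) powr (-s)) / s) \<le> p * ln (X / z0)"
  proof (intro mult_left_mono)
    have "1 - s * ln (X / z0) \<le> exp (- s * ln (X / z0))"
      using exp_ge_add_one_self[of "- s * ln (X / z0)"] by simp
    then have "1 - s * ln (X / z0) \<le> (X / z0) powr (-s)"
      using X z0 by (simp add: powr_def)
    then show "(1 - (X / z0) powr (-s)) / s \<le> ln (X / z0)"
      using s by (simp add: divide_simps mult.commute)
  qed (use p in simp)
  ultimately have "ln (A + c * z0) + p / s \<le> ln (A + c * X) + p / s * (X / z0) powr (-s)"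
    by (simp add: algebra_simps diff_divide_distrib)
  also have "p / s * (X / z0) powr (-s) = (p / s * z0 powr s / Gamma s) * (Gamma s / X powr s)"
    using X z0 Gamma_real_pos[OF s, THEN less_imp_neq] by (simp add: powr_minus powr_divide field_simps)
  finally have "ennreal (ln (A + c * z0) + p / s) \<le>
      ennreal (ln (A + c * X) + (p / s * z0 powr s / Gamma s) * (Gamma s / X powr s))"
    by (rule ennreal_leI)
  also have "\<dots> = ennreal (ln (A + c * X)) + ennreal (p / s * z0 powr s / Gamma s) * gamma_kernel s X"
  proof -
    have "A + c * X \<ge> 1" using A c X by (simp add: add_increasing2)
    then have nn: "0 \<le> ln (A + c * X)" "0 \<le> p / s * z0 powr s / Gamma s" "0 \<le> Gamma s / X powr s"
      using p s Gamma_real_pos[OF s] by auto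
    show ?thesis
      by (simp only: gamma_kernel_eq[OF s X] ennreal_plus[OF nn(1) mult_nonneg_nonneg[OF nn(2,3)]]
          ennreal_mult[OF nn(2,3)])
  qed
  finally show ?thesis .
qed

text \<open>The expression is a difference quotient at 0 of a function with value 1 there, whose
  derivative is \<open>Digamma a\<close> minus the logarithmic derivative of \<open>Gamma\<close> at
  \<open>a\<close>, hence 0.\<close>

lemma Gamma_exp_Digamma_quotient_limit:
  fixes a :: real
  assumes "a > 0"
  shows "((\<lambda>s. (exp (s * Digamma a) * Gamma (a - s) / Gamma a - 1) / s) \<longlongrightarrow> 0) (at_right 0)"
proof -
  have G: "Gamma a \<noteq> 0" using Gamma_real_pos[OF assms] by simp
  have "((\<lambda>s. exp (s * Digamma a) * Gamma (a - s) / Gamma a) has_field_derivative 0) (at 0)"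
    using assms G by (auto intro!: derivative_eq_intros simp: nonpos_Ints_def)
  then have "((\<lambda>s. (exp (s * Digamma a) * Gamma (a - s) / Gamma a - 1) / s) \<longlongrightarrow> 0) (at 0)"
    using G by (simp add: has_field_derivative_iff)
  then show ?thesis by (rule filterlim_mono[OF _ order_refl]) (simp add: at_le)
qed

text \<open>The bound in \<open>mom\<close> is \<open>Gamma s\<close> times the moment of order
  \<open>-s\<close> of \<open>\<theta>\<close> times a Gamma variable of shape \<open>a\<close>; the
  logarithm of that variable has mean \<open>ln (\<theta> * exp (Digamma a))\<close>. Integrating
  the tangent inequality at exactly this point and letting \<open>s\<close> tend to 0 gives the
  claim.\<close>

lemma nn_integral_ln_ge_of_negative_moments:
  fixes X :: "'a \<Rightarrow> real" and a b c \<theta> :: real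
  assumes "prob_space M" and X[measurable]: "X \<in> borel_measurable M" and X0: "\<And>x. X x \<ge> 0"
    and a: "a > 0" and b: "b \<ge> 0" and c: "c > 0" and \<theta>: "\<theta> > 0"
    and mom: "\<And>s. 0 < s \<Longrightarrow> s < a \<Longrightarrow>
      (\<integral>\<^sup>+x. gamma_kernel s (X x) \<partial>M) \<le> ennreal (Gamma s * Gamma (a - s) / (Gamma a * \<theta> powr s))"
  shows "ennreal (ln (1 + c * (b + \<theta> * exp (Digamma a)))) \<le> (\<integral>\<^sup>+x. ln (1 + c * (b + X x)) \<partial>M)"
proof -
  interpret prob_space M by fact
  define A where "A = 1 + c * b"
  define z0 where "z0 = \<theta> * exp (Digamma a)"
  define p where "p = c * z0 / (A + c * z0)"
  have A: "A \<ge> 1" using b c by (simp add: A_def)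
  have z0: "z0 > 0" using \<theta> by (simp add: z0_def)
  have p: "p > 0" using A c z0 by (simp add: p_def add_pos_pos)
  let ?J = "\<integral>\<^sup>+x. ln (A + c * X x) \<partial>M"
  have "ennreal (ln (A + c * z0)) \<le> ?J"
  proof (cases ?J)
    \<comment> \<open>An infinite expectation is trivial; a finite one can be subtracted over the
      reals.\<close>
    case (real j)
    have bound: "ln (A + c * z0) - j \<le> p * ((exp (s * Digamma a) * Gamma (a - s) / Gamma a - 1) / s)"
      if s: "0 < s" "s < a" for s
    proof -
      have G: "Gamma s > 0" "Gamma (a - s) > 0" "Gamma a > 0"
        using s by (auto intro!: Gamma_real_pos)
      let ?K = "p / s * z0 powr s / Gamma s"
      have "ennreal (ln (A + c * z0) + p / s) = (\<integral>\<^sup>+x. ennreal (ln (A + c * z0) + p / s) \<partial>M)"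
        by (simp add: emeasure_space_1)
      also have "\<dots> \<le> (\<integral>\<^sup>+x. ennreal (ln (A + c * X x)) + ennreal ?K * gamma_kernel s (X x) \<partial>M)"
        unfolding p_def using ln_tangent_gamma_kernel[OF A c z0 s(1) X0] by (intro nn_integral_mono) auto
      also have "\<dots> = ?J + ennreal ?K * (\<integral>\<^sup>+x. gamma_kernel s (X x) \<partial>M)"
        by (simp add: nn_integral_add nn_integral_cmult)
      also have "\<dots> \<le> ?J + ennreal ?K * ennreal (Gamma s * Gamma (a - s) / (Gamma a * \<theta> powr s))"
        using mom[OF s] by (intro add_mono mult_left_mono) auto
      also have "\<dots> = ennreal (j + ?K * (Gamma s * Gamma (a - s) / (Gamma a * \<theta> powr s)))"
        using real G p s \<theta> by (simp flip: ennreal_mult ennreal_plus)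
      also have "?K * (Gamma s * Gamma (a - s) / (Gamma a * \<theta> powr s)) =
          p / s * (exp (s * Digamma a) * Gamma (a - s) / Gamma a)"
        using G(1,2,3)[THEN less_imp_neq] \<theta> s by (simp add: z0_def powr_mult exp_powr_real field_simps)
      finally have "ln (A + c * z0) + p / s \<le> j + p / s * (exp (s * Digamma a) * Gamma (a - s) / Gamma a)"
        using real G p s by (subst (asm) ennreal_le_iff) auto
      then show ?thesis by (simp add: algebra_simps diff_divide_distrib)
    qed
    \<comment> \<open>The error is \<open>p\<close> times a quotient tending to 0. The factor
      \<open>exp (s * Digamma a)\<close> in it comes from \<open>z0 powr s\<close>, which is why the
      tangent point contains \<open>exp (Digamma a)\<close>.\<close>
    have "((\<lambda>s. p * ((exp (s * Digamma a) * Gamma (a - s) / Gamma a - 1) / s)) \<longlongrightarrow> p * 0) (at_right 0)"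
      by (intro tendsto_intros Gamma_exp_Digamma_quotient_limit a)
    moreover have "\<forall>\<^sub>F s in at_right 0. ln (A + c * z0) - j \<le>
        p * ((exp (s * Digamma a) * Gamma (a - s) / Gamma a - 1) / s)"
      unfolding eventually_at_right_field using a bound by (intro exI[of _ a]) auto
    ultimately have "ln (A + c * z0) - j \<le> p * 0"
      by (intro tendsto_lowerbound[of _ _ "at_right 0"]) auto
    then show ?thesis using real by (simp add: ennreal_leI)
  qed simp
  then show ?thesis
    by (simp add: A_def z0_def algebra_simps)
qed

section \<open>Gaussian quadratic forms\<close>

lemma nn_integral_gaussian_exp_square:
  assumes s: "s > 0" and k: "k \<ge> 0"
  shows "(\<integral>\<^sup>+x. ennreal (exp (- (k * x\<^sup>2))) \<partial>gaussian s) = ennreal ((1 + 2 * k * s\<^sup>2) powr (- 1 / 2))"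
proof -
  define r where "r = sqrt (1 + 2 * k * s\<^sup>2)"
  have r2: "r\<^sup>2 = 1 + 2 * k * s\<^sup>2" using k by (simp add: r_def)
  have r: "r > 0" using k by (simp add: r_def add_pos_nonneg)
  have "normal_density 0 s x * exp (- (k * x\<^sup>2)) = 1 / r * normal_density 0 (s / r) x" for x
  proof -
    have "- x\<^sup>2 / (2 * s\<^sup>2) - k * x\<^sup>2 = - x\<^sup>2 / (2 * (s / r)\<^sup>2)"
      using s r by (simp add: power_divide r2 field_simps)
    then show ?thesis
      using s r by (simp add: normal_density_def power_divide real_sqrt_divide flip: exp_add)
  qed
  then have "(\<integral>\<^sup>+x. ennreal (exp (- (k * x\<^sup>2))) \<partial>gaussian s) =
      (\<integral>\<^sup>+x. ennreal (1 / r) * ennreal (normal_density 0 (s / r) x) \<partial>lborel)"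
    using r by (subst nn_integral_density) (auto simp flip: ennreal_mult)
  also have "\<dots> = ennreal (1 / r)"
  proof -
    have "(\<integral>\<^sup>+x. ennreal (normal_density 0 (s / r) x) \<partial>lborel) = 1"
      using s r by (subst nn_integral_eq_integral) auto
    then show ?thesis by (simp add: nn_integral_cmult)
  qed
  also have "1 / r = (1 + 2 * k * s\<^sup>2) powr (- 1 / 2)"
  proof -
    have "1 / r = inverse ((1 + 2 * k * s\<^sup>2) powr (1 / 2))"
      using k by (simp only: r_def inverse_eq_divide) (subst powr_half_sqrt; simp)
    then show ?thesis
      by (simp only: powr_minus[symmetric] minus_divide_left)
  qed
  finally show ?thesis .
qed

text \<open>By independence the transform is a product of factors
  \<open>(1 + l i * y) powr (- 1 / 2)\<close> with \<open>y = 2 * s\<^sup>2 * u\<close>. Bernoulli's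
  inequality bounds each by \<open>(1 + y) powr (- (l i / 2))\<close>, and the exponents add up. The
  result is the Laplace transform of \<open>s\<^sup>2\<close> times a chi-square variable with
  \<open>\<tau>\<close> degrees of freedom, \<open>\<tau>\<close> being any real below the sum of
  weights.\<close>

lemma nn_integral_exp_weighted_squares_le:
  fixes l :: "'m::finite \<Rightarrow> real"
  assumes s: "s > 0" and u: "u \<ge> 0" and l: "\<And>i. 0 \<le> l i" "\<And>i. l i \<le> 1" and \<tau>: "\<tau> \<le> (\<Sum>i\<in>UNIV. l i)"
  shows "(\<integral>\<^sup>+x. ennreal (exp (- (u * (\<Sum>i\<in>UNIV. l i * (x i)\<^sup>2)))) \<partial>PiM UNIV (\<lambda>_::'m. gaussian s))
    \<le> ennreal ((1 + 2 * s\<^sup>2 * u) powr (- (\<tau> / 2)))"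
proof -
  interpret product_sigma_finite "\<lambda>_::'m. gaussian s"
    using s by (simp add: product_sigma_finite_def prob_space_imp_sigma_finite prob_space_normal_density)
  let ?y = "2 * s\<^sup>2 * u"
  have y: "?y \<ge> 0" using u by simp
  then have y1: "1 + ?y > 0" by linarith
  have "(\<integral>\<^sup>+x. ennreal (exp (- (u * (\<Sum>i\<in>UNIV. l i * (x i)\<^sup>2)))) \<partial>PiM UNIV (\<lambda>_::'m. gaussian s))
    = (\<integral>\<^sup>+x. (\<Prod>i\<in>UNIV. ennreal (exp (- (u * l i * (x i)\<^sup>2)))) \<partial>PiM UNIV (\<lambda>_::'m. gaussian s))"
    by (intro nn_integral_cong)
       (simp add: prod_ennreal sum_distrib_left mult.assoc flip: exp_sum sum_negf)
  also have "\<dots> = (\<Prod>i\<in>UNIV. ennreal ((1 + 2 * (u * l i) * s\<^sup>2) powr (- 1 / 2)))"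
    using u l s by (subst product_nn_integral_prod) (auto simp: nn_integral_gaussian_exp_square)
  also have "\<dots> \<le> ennreal (\<Prod>i\<in>UNIV. (1 + ?y) powr (- (l i / 2)))"
    unfolding prod_ennreal[OF powr_ge_zero]
  proof (intro ennreal_leI prod_mono conjI)
    fix i
    have "(1 + ?y) powr l i \<le> 1 + l i * ?y" by (rule one_plus_powr_le[OF l y])
    then have "(1 + l i * ?y) powr (- 1 / 2) \<le> ((1 + ?y) powr l i) powr (- 1 / 2)"
      using y1 by (intro powr_mono2') auto
    then show "(1 + 2 * (u * l i) * s\<^sup>2) powr (- 1 / 2) \<le> (1 + ?y) powr (- (l i / 2))"
      by (simp add: powr_powr mult_ac)
  qed auto
  also have "\<dots> = ennreal ((1 + ?y) powr (\<Sum>i\<in>UNIV. - (l i / 2)))"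
    using y1 by (subst powr_sum) auto
  also have "\<dots> \<le> ennreal ((1 + ?y) powr (- (\<tau> / 2)))"
  proof (intro ennreal_leI powr_mono)
    have "(\<Sum>i\<in>UNIV. - (l i / 2)) = - ((\<Sum>i\<in>UNIV. l i) / 2)"
      by (simp only: sum_negf sum_divide_distrib)
    then show "(\<Sum>i\<in>UNIV. - (l i / 2)) \<le> - (\<tau> / 2)" using \<tau> by linarith
    show "1 \<le> 1 + ?y" using y by linarith
  qed
  finally show ?thesis .
qed

text \<open>A Beta integral: write \<open>(1 + \<theta> * u) powr (- a)\<close> as a Gamma integral
  over \<open>y\<close>, exchange the integrals, and both become Gamma integrals.\<close>

lemma nn_integral_beta_kernel:
  fixes a s \<theta> :: real
  assumes s: "0 < s" "s < a" and \<theta>: "\<theta> > 0"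
  shows "(\<integral>\<^sup>+u. ennreal (indicator {0..} u * u powr (s - 1)) * ennreal ((1 + \<theta> * u) powr (- a)) \<partial>lborel) =
    ennreal (Gamma s * Gamma (a - s) / (Gamma a * \<theta> powr s))"
proof -
  have G: "Gamma s > 0" "Gamma (a - s) > 0" and Ga: "Gamma a > 0"
    using s by (auto intro!: Gamma_real_pos)
  from Ga have Ga': "Gamma a \<noteq> 0" by (metis less_irrefl)
  let ?g = "\<lambda>s u. ennreal (indicator {0..} u * u powr (s - 1)) :: ennreal"
  have "(\<integral>\<^sup>+u. ?g s u * ennreal ((1 + \<theta> * u) powr (- a)) \<partial>lborel) =
      (\<integral>\<^sup>+u. ?g s u * (ennreal (1 / Gamma a) * (\<integral>\<^sup>+y. ?g a y * ennreal (exp (- (y * (1 + \<theta> * u)))) \<partial>lborel)) \<partial>lborel)"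
  proof (intro nn_integral_cong)
    fix u :: real
    have "ennreal ((1 + \<theta> * u) powr (- a)) = ennreal (1 / Gamma a) * gamma_kernel a (1 + \<theta> * u)" if "u \<ge> 0"
      using that \<theta> s Ga Ga' by (subst gamma_kernel_eq) (auto simp: add_pos_nonneg powr_minus divide_inverse simp flip: ennreal_mult)
    then show "?g s u * ennreal ((1 + \<theta> * u) powr (- a)) =
      ?g s u * (ennreal (1 / Gamma a) * (\<integral>\<^sup>+y. ?g a y * ennreal (exp (- (y * (1 + \<theta> * u)))) \<partial>lborel))"
      by (cases "u \<ge> 0") (auto simp: gamma_kernel_def ennreal_mult)
  qed
  also have "\<dots> = ennreal (1 / Gamma a) *
      (\<integral>\<^sup>+u. (\<integral>\<^sup>+y. ?g s u * (?g a y * ennreal (exp (- (y * (1 + \<theta> * u))))) \<partial>lborel) \<partial>lborel)"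
    by (simp add: nn_integral_cmult mult.left_commute)
  also have "(\<integral>\<^sup>+u. (\<integral>\<^sup>+y. ?g s u * (?g a y * ennreal (exp (- (y * (1 + \<theta> * u))))) \<partial>lborel) \<partial>lborel) =
      (\<integral>\<^sup>+y. (\<integral>\<^sup>+u. ?g s u * (?g a y * ennreal (exp (- (y * (1 + \<theta> * u))))) \<partial>lborel) \<partial>lborel)"
    by (rule lborel_pair.Fubini') measurable
  also have "\<dots> = (\<integral>\<^sup>+y. ennreal (Gamma s / \<theta> powr s) * ennreal (indicator {0..} y * y powr (a - s - 1) / exp y) \<partial>lborel)"
  proof (intro nn_integral_cong)
    fix y :: real
    have "(\<integral>\<^sup>+u. ?g s u * (?g a y * ennreal (exp (- (y * (1 + \<theta> * u))))) \<partial>lborel) =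
      (\<integral>\<^sup>+u. ?g a y * ennreal (exp (- y)) * ennreal (indicator {0..} u * u powr (s - 1) * exp (- (u * (\<theta> * y)))) \<partial>lborel)"
      by (intro nn_integral_cong) (auto simp: indicator_def algebra_simps exp_diff exp_minus divide_inverse simp flip: ennreal_mult)
    also have "\<dots> = ?g a y * ennreal (exp (- y)) * gamma_kernel s (\<theta> * y)"
      by (simp add: nn_integral_cmult gamma_kernel_def)
    also have "\<dots> = ennreal (Gamma s / \<theta> powr s) * ennreal (indicator {0..} y * y powr (a - s - 1) / exp y)"
    proof (cases "y > 0")
      case True
      have "y powr (a - s - 1) = y powr (a - 1) / y powr s"
        using True by (simp flip: powr_diff add: algebra_simps)
      then show ?thesis using True s \<theta> G
        by (simp add: gamma_kernel_eq powr_mult exp_minus divide_inverse mult_ac flip: ennreal_mult)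
    qed (auto simp: indicator_def)
    finally show "(\<integral>\<^sup>+u. ?g s u * (?g a y * ennreal (exp (- (y * (1 + \<theta> * u))))) \<partial>lborel) =
      ennreal (Gamma s / \<theta> powr s) * ennreal (indicator {0..} y * y powr (a - s - 1) / exp y)" .
  qed
  also have "\<dots> = ennreal (Gamma s / \<theta> powr s) * ennreal (Gamma (a - s))"
    using s by (subst nn_integral_cmult) (auto simp: Gamma_conv_nn_integral_real)
  also have "ennreal (1 / Gamma a) * \<dots> = ennreal (Gamma s * Gamma (a - s) / (Gamma a * \<theta> powr s))"
    using G Ga Ga' by (simp add: mult_ac flip: ennreal_mult)
  finally show ?thesis .
qed

text \<open>Exchanging expectation and the integral defining the kernel leaves the Laplace transform
  bounded above, integrated against \<open>u powr (s - 1)\<close>. This supplies the moment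
  hypothesis with shape \<open>\<tau> / 2\<close> and scale
  \<open>2 * \<sigma>\<^sup>2\<close>.\<close>

lemma nn_integral_gamma_kernel_weighted_squares_le:
  fixes l :: "'m::finite \<Rightarrow> real"
  assumes \<sigma>: "\<sigma> > 0" and l: "\<And>i. 0 \<le> l i" "\<And>i. l i \<le> 1" and \<tau>: "\<tau> \<le> (\<Sum>i\<in>UNIV. l i)"
    and s: "0 < s" "s < \<tau> / 2"
  shows "(\<integral>\<^sup>+x. gamma_kernel s (\<Sum>i\<in>UNIV. l i * (x i)\<^sup>2) \<partial>PiM UNIV (\<lambda>_::'m. gaussian \<sigma>))
    \<le> ennreal (Gamma s * Gamma (\<tau> / 2 - s) / (Gamma (\<tau> / 2) * (2 * \<sigma>\<^sup>2) powr s))"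
proof -
  interpret G: prob_space "gaussian \<sigma>" using \<sigma> by (rule prob_space_normal_density)
  interpret P: prob_space "PiM UNIV (\<lambda>_::'m. gaussian \<sigma>)"
    by (rule prob_space_PiM) (simp add: G.prob_space_axioms)
  interpret pair_sigma_finite "PiM UNIV (\<lambda>_::'m. gaussian \<sigma>)" lborel ..
  let ?X = "\<lambda>x. \<Sum>i\<in>UNIV. l i * (x i)\<^sup>2"
  let ?g = "\<lambda>u. ennreal (indicator {0..} u * u powr (s - 1)) :: ennreal"
  have [measurable]: "(\<lambda>x. x i) \<in> borel_measurable (PiM UNIV (\<lambda>_::'m. gaussian \<sigma>))" for i
    using measurable_component_singleton[of i UNIV "\<lambda>_::'m. gaussian \<sigma>"] by simp
  have "(\<integral>\<^sup>+x. gamma_kernel s (?X x) \<partial>PiM UNIV (\<lambda>_::'m. gaussian \<sigma>)) =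
    (\<integral>\<^sup>+x. (\<integral>\<^sup>+u. ?g u * ennreal (exp (- (u * ?X x))) \<partial>lborel) \<partial>PiM UNIV (\<lambda>_::'m. gaussian \<sigma>))"
    by (simp add: gamma_kernel_def ennreal_mult)
  also have "\<dots> = (\<integral>\<^sup>+u. (\<integral>\<^sup>+x. ?g u * ennreal (exp (- (u * ?X x))) \<partial>PiM UNIV (\<lambda>_::'m. gaussian \<sigma>)) \<partial>lborel)"
    by (rule Fubini'[symmetric]) measurable
  also have "\<dots> = (\<integral>\<^sup>+u. ?g u * (\<integral>\<^sup>+x. ennreal (exp (- (u * ?X x))) \<partial>PiM UNIV (\<lambda>_::'m. gaussian \<sigma>)) \<partial>lborel)"
    by (simp add: nn_integral_cmult)
  also have "\<dots> \<le> (\<integral>\<^sup>+u. ?g u * ennreal ((1 + 2 * \<sigma>\<^sup>2 * u) powr (- (\<tau> / 2))) \<partial>lborel)"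
  proof (rule nn_integral_mono)
    fix u :: real
    show "?g u * (\<integral>\<^sup>+x. ennreal (exp (- (u * ?X x))) \<partial>PiM UNIV (\<lambda>_::'m. gaussian \<sigma>))
      \<le> ?g u * ennreal ((1 + 2 * \<sigma>\<^sup>2 * u) powr (- (\<tau> / 2)))"
      \<comment> \<open>For \<open>u < 0\<close> the weight \<open>?g u\<close> vanishes, so the
        transform is bounded only where it is needed.\<close>
      by (cases "u \<ge> 0") (auto intro!: mult_left_mono nn_integral_exp_weighted_squares_le \<sigma> l \<tau>)
  qed
  also have "\<dots> = ennreal (Gamma s * Gamma (\<tau> / 2 - s) / (Gamma (\<tau> / 2) * (2 * \<sigma>\<^sup>2) powr s))"
    using s \<sigma> by (intro nn_integral_beta_kernel) auto
  finally show ?thesis .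
qed

text \<open>In an orthonormal eigenbasis the form becomes a weighted sum of squares. The bounds on
  the form put the eigenvalues in [0, 1], their sum is the trace, and rotation invariance makes the
  new coordinates independent Gaussians again.\<close>

lemma nn_integral_ln_gaussian_quadratic_form:
  fixes Q :: "real^'m::finite^'m"
  assumes \<sigma>: "\<sigma> > 0" and b: "b \<ge> 0" and c: "c > 0" and \<tau>: "\<tau> > 0" "\<tau> \<le> trace Q"
    and sym: "transpose Q = Q" and nn: "\<And>x. 0 \<le> x \<bullet> (Q *v x)" and le: "\<And>x. x \<bullet> (Q *v x) \<le> x \<bullet> x"
  shows "ennreal (ln (1 + c * (b + 2 * \<sigma>\<^sup>2 * exp (Digamma (\<tau> / 2))))) \<le>
    (\<integral>\<^sup>+x. ln (1 + c * (b + (\<chi> i. x i) \<bullet> (Q *v (\<chi> i. x i)))) \<partial>PiM UNIV (\<lambda>_::'m. gaussian \<sigma>))"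
proof -
  interpret G: prob_space "gaussian \<sigma>" using \<sigma> by (rule prob_space_normal_density)
  have prob: "prob_space (PiM UNIV (\<lambda>_::'m. gaussian \<sigma>))"
    by (rule prob_space_PiM) (simp add: G.prob_space_axioms)
  obtain U l where U: "orthogonal_matrix U" and Ul: "\<And>i. Q *v row i U = l i *\<^sub>R row i U"
    using real_symmetric_diagonalization[OF sym] by auto
  define D :: "real^'m^'m" where "D = (\<chi> i j. if i = j then l i else 0)"
  have UU: "U ** transpose U = mat 1" "transpose U ** U = mat 1"
    using U by (simp_all add: orthogonal_matrix_def)
  have QU: "Q ** transpose U = transpose U ** D"
  proof -
    have "(Q ** transpose U) $ a $ i = (transpose U ** D) $ a $ i" for a i
    proof -
      have "(Q ** transpose U) $ a $ i = (Q *v row i U) $ a"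
        by (simp add: matrix_matrix_mult_def matrix_vector_mult_def transpose_def row_def)
      also have "\<dots> = (transpose U ** D) $ a $ i"
        unfolding Ul by (simp add: D_def matrix_matrix_mult_def transpose_def row_def mult.commute if_distrib cong: if_cong)
      finally show ?thesis .
    qed
    then show ?thesis by (simp add: vec_eq_iff)
  qed
  have Q: "Q = transpose U ** D ** U"
    by (metis QU UU(2) matrix_mul_assoc matrix_mul_rid)
  have form: "y \<bullet> (Q *v y) = (\<Sum>i\<in>UNIV. l i * ((U *v y) $ i)\<^sup>2)" for y
  proof -
    have "y \<bullet> (Q *v y) = (U *v y) \<bullet> (D *v (U *v y))"
      unfolding Q by (metis dot_lmul_matrix matrix_vector_mul_assoc transpose_matrix_vector transpose_transpose)
    also have "\<dots> = (\<Sum>i\<in>UNIV. l i * ((U *v y) $ i)\<^sup>2)"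
    proof -
      have "(D *v v) $ i = (\<Sum>j\<in>UNIV. if i = j then l j * v $ j else 0)" for v i
        by (simp only: vec_lambda_beta D_def matrix_vector_mult_def) (rule sum.cong, auto)
      then have "(D *v v) $ i = l i * v $ i" for v i by simp
      then show ?thesis by (simp add: inner_vec_def power2_eq_square mult_ac)
    qed
    finally show ?thesis .
  qed
  have nrow: "row i U \<bullet> row i U = 1" for i
    using U by (simp add: orthogonal_matrix_orthonormal_rows dot_square_norm)
  have l: "0 \<le> l i" "l i \<le> 1" for i
    using nn[of "row i U"] le[of "row i U"] by (simp_all add: Ul nrow)
  have "trace Q = trace (D ** (U ** transpose U))"
    unfolding Q by (metis matrix_mul_assoc trace_mul_sym)
  then have "trace Q = (\<Sum>i\<in>UNIV. l i)"
    by (simp add: UU trace_def D_def)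
  then have \<tau>l: "\<tau> \<le> (\<Sum>i\<in>UNIV. l i)" using \<tau> by simp
  have [measurable]: "(\<lambda>x. x i) \<in> borel_measurable (PiM UNIV (\<lambda>_::'m. gaussian \<sigma>))" for i
    using measurable_component_singleton[of i UNIV "\<lambda>_::'m. gaussian \<sigma>"] by simp
  have "ennreal (ln (1 + c * (b + 2 * \<sigma>\<^sup>2 * exp (Digamma (\<tau> / 2))))) \<le>
    (\<integral>\<^sup>+x. ln (1 + c * (b + (\<Sum>i\<in>UNIV. l i * (x i)\<^sup>2))) \<partial>PiM UNIV (\<lambda>_::'m. gaussian \<sigma>))"
    by (rule nn_integral_ln_ge_of_negative_moments[OF prob])
       (use \<sigma> b c \<tau> l \<tau>l in \<open>auto intro!: sum_nonneg nn_integral_gamma_kernel_weighted_squares_le\<close>)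
  also have "\<dots> = (\<integral>\<^sup>+x. ln (1 + c * (b + (\<Sum>i\<in>UNIV. l i * (\<Sum>j\<in>UNIV. U $ i $ j * x j)\<^sup>2))) \<partial>PiM UNIV (\<lambda>_::'m. gaussian \<sigma>))"
    by (rule nn_integral_PiM_gaussian_orthogonal[OF \<sigma> U, symmetric]) measurable
  also have "\<dots> = (\<integral>\<^sup>+x. ln (1 + c * (b + (\<chi> i. x i) \<bullet> (Q *v (\<chi> i. x i)))) \<partial>PiM UNIV (\<lambda>_::'m. gaussian \<sigma>))"
    by (simp add: form) (simp add: matrix_vector_mult_def)
  finally show ?thesis .
qed

section \<open>Rank-one updates of Gram matrices\<close>

definition rank_one :: "'a::times^'n \<Rightarrow> 'a^'m \<Rightarrow> 'a^'m^'n" where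
  "rank_one x y = (\<chi> a b. x $ a * y $ b)"

definition conj_vec :: "complex^'n \<Rightarrow> complex^'n" where
  "conj_vec x = (\<chi> a. cnj (x $ a))"

text \<open>The matrix \<open>1 + c V^H V\<close>, where \<open>V\<close> has the rows
  \<open>v k\<close> for \<open>k\<close> in \<open>S\<close>. A set of row indices, rather than a
  whole type, allows rows to be added one at a time.\<close>

definition gram :: "real \<Rightarrow> ('k \<Rightarrow> complex^'m) \<Rightarrow> 'k set \<Rightarrow> complex^'m^'m" where
  "gram c v S = (\<chi> a b. (if a = b then 1 else 0) + of_real c * (\<Sum>k\<in>S. cnj (v k $ a) * v k $ b))"

lemma matrix_inv_right: "invertible M \<Longrightarrow> M ** matrix_inv M = mat 1"
  and matrix_inv_left: "invertible M \<Longrightarrow> matrix_inv M ** M = mat 1"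
  unfolding invertible_def matrix_inv_def by (metis (mono_tags, lifting) someI_ex)+

text \<open>The matrix determinant lemma: after factoring out \<open>M\<close>, Sylvester's identity
  reduces the remaining rank-one perturbation to a 1 by 1 determinant.\<close>

lemma det_rank_one_update:
  fixes M :: "'a::field^'m::finite^'m"
  assumes M: "invertible M"
  shows "det (M + rank_one x y) = det M * (1 + (\<Sum>a\<in>UNIV. y $ a * (matrix_inv M *v x) $ a))"
proof -
  let ?X = "(\<chi> a _. (matrix_inv M *v x) $ a) :: 'a^1^'m" and ?Y = "(\<chi> _. y) :: 'a^'m^1"
  have inv: "M ** matrix_inv M = mat 1"
    using matrix_inv_right[OF M] .
  have "M ** (?X ** ?Y) = rank_one (M *v (matrix_inv M *v x)) y"
    by (simp add: vec_eq_iff matrix_matrix_mult_def matrix_vector_mult_def rank_one_def sum_distrib_right mult.assoc)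
  then have "M + rank_one x y = M ** (mat 1 + ?X ** ?Y)"
    by (simp add: matrix_add_ldistrib matrix_vector_mul_assoc inv)
  then have "det (M + rank_one x y) = det M * det (mat 1 + ?Y ** ?X)"
    using sylvester_determinant[of ?X ?Y] by (simp add: det_mul)
  then show ?thesis
    by (simp add: det_1 matrix_matrix_mult_def mat_def)
qed

lemma gram_empty [simp]: "gram c v {} = mat 1"
  by (simp add: gram_def mat_def)

lemma gram_cong: "(\<And>k. k \<in> S \<Longrightarrow> v k = w k) \<Longrightarrow> gram c v S = gram c w S"
  by (simp add: gram_def cong: sum.cong)

lemma gram_insert:
  assumes "finite S" "k \<notin> S"
  shows "gram c v (insert k S) = gram c v S + rank_one (of_real c *s conj_vec (v k)) (v k)"
  using assms by (simp add: vec_eq_iff gram_def rank_one_def conj_vec_def distrib_left mult.assoc add_ac)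

lemma gram_mult_vec:
  fixes v :: "'k \<Rightarrow> complex^'m::finite"
  assumes "finite S"
  shows "(gram c v S *v y) $ a = y $ a + of_real c * (\<Sum>k\<in>S. cnj (v k $ a) * (\<Sum>b\<in>UNIV. v k $ b * y $ b))"
proof -
  have "(gram c v S *v y) $ a = (\<Sum>b\<in>UNIV. (if a = b then y $ b else 0) +
      of_real c * (\<Sum>k\<in>S. cnj (v k $ a) * (v k $ b * y $ b)))"
    unfolding matrix_vector_mult_def gram_def vec_lambda_beta
    by (intro sum.cong) (auto simp: distrib_right sum_distrib_right mult.assoc)
  also have "\<dots> = y $ a + of_real c * (\<Sum>b\<in>UNIV. \<Sum>k\<in>S. cnj (v k $ a) * (v k $ b * y $ b))"
    by (simp add: sum.distrib sum_distrib_left)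
  also have "(\<Sum>b\<in>UNIV. \<Sum>k\<in>S. cnj (v k $ a) * (v k $ b * y $ b)) =
      (\<Sum>k\<in>S. cnj (v k $ a) * (\<Sum>b\<in>UNIV. v k $ b * y $ b))"
    by (subst sum.swap) (simp add: sum_distrib_left)
  finally show ?thesis .
qed

lemma gram_quadratic_form:
  fixes v :: "'k \<Rightarrow> complex^'m::finite"
  assumes "finite S"
  shows "(\<Sum>a\<in>UNIV. cnj (y $ a) * (gram c v S *v y) $ a) =
    of_real ((\<Sum>a\<in>UNIV. (cmod (y $ a))\<^sup>2) + c * (\<Sum>k\<in>S. (cmod (\<Sum>b\<in>UNIV. v k $ b * y $ b))\<^sup>2))"
proof -
  let ?t = "\<lambda>k. \<Sum>b\<in>UNIV. v k $ b * y $ b"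
  have "(\<Sum>a\<in>UNIV. cnj (y $ a) * (gram c v S *v y) $ a) =
    (\<Sum>a\<in>UNIV. cnj (y $ a) * y $ a) + of_real c * (\<Sum>a\<in>UNIV. \<Sum>k\<in>S. cnj (y $ a) * (cnj (v k $ a) * ?t k))"
    by (simp add: gram_mult_vec[OF assms] distrib_left sum.distrib sum_distrib_left mult_ac)
  also have "(\<Sum>a\<in>UNIV. \<Sum>k\<in>S. cnj (y $ a) * (cnj (v k $ a) * ?t k)) = (\<Sum>k\<in>S. cnj (?t k) * ?t k)"
  proof -
    have "(\<Sum>a\<in>UNIV. cnj (y $ a) * (cnj (v k $ a) * t)) = cnj (?t k) * t" for k t
      by (simp add: sum_distrib_left sum_distrib_right mult_ac)
    then show ?thesis by (subst sum.swap) simp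
  qed
  finally show ?thesis
    by (simp add: complex_norm_square mult.commute del: of_real_power)
qed

lemma conj_transpose_gram: "finite S \<Longrightarrow> cmat_adj (gram c v S) = gram c v S"
  for v :: "'k \<Rightarrow> complex^'m::finite"
  by (simp add: vec_eq_iff cmat_adj_def gram_def mult.commute)

lemma cmat_adj_mult: "cmat_adj (A ** B) = cmat_adj B ** cmat_adj A"
  for A :: "complex^'m::finite^'n::finite" and B :: "complex^'k::finite^'m"
  by (simp add: vec_eq_iff cmat_adj_def matrix_matrix_mult_def mult.commute)

lemma cmat_adj_mat_1 [simp]: "cmat_adj (mat 1) = mat 1"
  by (simp add: vec_eq_iff cmat_adj_def mat_def)

text \<open>For a row vector \<open>w\<close> this is \<open>w M^-1 w^H\<close>, the quantity by
  which a new row enters the determinant.\<close>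

definition inv_form :: "complex^'m^'m \<Rightarrow> complex^'m::finite \<Rightarrow> complex" where
  "inv_form M w = (\<Sum>a\<in>UNIV. w $ a * (matrix_inv M *v conj_vec w) $ a)"

section \<open>Bounds on the quadratic form and trace of an inverse Gram matrix\<close>

context
  fixes v :: "'k \<Rightarrow> complex^'m::finite" and S c
  assumes S: "finite S" and c: "c > 0" and inv: "invertible (gram c v S)"
begin

text \<open>With \<open>y = M^-1 w^H\<close> the form is the conjugate of \<open>y^H M y\<close>, a
  real number. The explicit sum of squares then yields reality, positivity and the upper bounds
  below.\<close>

lemma inv_form_eq:
  assumes "y = matrix_inv (gram c v S) *v conj_vec w"
  shows "inv_form (gram c v S) w =
    of_real ((\<Sum>a\<in>UNIV. (cmod (y $ a))\<^sup>2) + c * (\<Sum>k\<in>S. (cmod (\<Sum>b\<in>UNIV. v k $ b * y $ b))\<^sup>2))"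
proof -
  have "gram c v S *v y = conj_vec w"
    unfolding assms by (simp add: matrix_vector_mul_assoc matrix_inv_right[OF inv])
  moreover have "inv_form (gram c v S) w = (\<Sum>a\<in>UNIV. w $ a * y $ a)"
    by (simp add: inv_form_def assms)
  ultimately have "cnj (inv_form (gram c v S) w) = (\<Sum>a\<in>UNIV. cnj (y $ a) * (gram c v S *v y) $ a)"
    by (simp add: conj_vec_def mult.commute)
  then have "cnj (cnj (inv_form (gram c v S) w)) = cnj (of_real ((\<Sum>a\<in>UNIV. (cmod (y $ a))\<^sup>2)
      + c * (\<Sum>k\<in>S. (cmod (\<Sum>b\<in>UNIV. v k $ b * y $ b))\<^sup>2)))"
    by (simp only: gram_quadratic_form[OF S])
  then show ?thesis
    by (simp only: complex_cnj_cnj complex_cnj_complex_of_real)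
qed

lemma Im_inv_form: "Im (inv_form (gram c v S) w) = 0"
  by (simp add: inv_form_eq[OF refl])

lemma inv_form_nonneg: "0 \<le> Re (inv_form (gram c v S) w)"
  using c by (simp add: inv_form_eq[OF refl] sum_nonneg)

text \<open>Write \<open>q\<close> for the form. Expanding the squared distance between
  \<open>w^H\<close> and \<open>y = M^-1 w^H\<close> gives \<open>2 q \<le> |w|^2 + |y|^2\<close>,
  and \<open>|y|^2 \<le> q\<close> since it is one part of the sum of squares.\<close>

lemma inv_form_le: "Re (inv_form (gram c v S) w) \<le> (\<Sum>a\<in>UNIV. (cmod (w $ a))\<^sup>2)"
proof -
  define y where "y = matrix_inv (gram c v S) *v conj_vec w"
  have "0 \<le> (\<Sum>a\<in>UNIV. (cmod (cnj (w $ a) - y $ a))\<^sup>2)" by (simp add: sum_nonneg)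
  also have "\<dots> = (\<Sum>a\<in>UNIV. (cmod (w $ a))\<^sup>2 + (cmod (y $ a))\<^sup>2 - 2 * Re (w $ a * y $ a))"
    by (intro sum.cong refl) (simp only: cmod_power2, simp add: power2_eq_square algebra_simps)
  also have "\<dots> = (\<Sum>a\<in>UNIV. (cmod (w $ a))\<^sup>2) + (\<Sum>a\<in>UNIV. (cmod (y $ a))\<^sup>2) - 2 * Re (inv_form (gram c v S) w)"
    by (simp add: sum.distrib sum_subtractf inv_form_def y_def sum_distrib_left)
  also have "(\<Sum>a\<in>UNIV. (cmod (y $ a))\<^sup>2) \<le> Re (inv_form (gram c v S) w)"
    using c by (simp add: inv_form_eq[OF y_def] sum_nonneg)
  finally show ?thesis by simp
qed

text \<open>For a row already in \<open>S\<close>, the summand of index \<open>k\<close> in the sum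
  of squares is the square of the form \<open>q\<close> itself, so
  \<open>c q^2 \<le> q\<close>.\<close>

lemma scaled_inv_form_row_le_1:
  assumes "k \<in> S"
  shows "c * Re (inv_form (gram c v S) (v k)) \<le> 1"
proof -
  define y where "y = matrix_inv (gram c v S) *v conj_vec (v k)"
  let ?q = "inv_form (gram c v S) (v k)"
  have "c * (Re ?q)\<^sup>2 = c * (cmod (\<Sum>b\<in>UNIV. v k $ b * y $ b))\<^sup>2"
    using Im_inv_form[of "v k"] by (simp add: cmod_power2 y_def flip: inv_form_def)
  also have "\<dots> \<le> c * (\<Sum>k\<in>S. (cmod (\<Sum>b\<in>UNIV. v k $ b * y $ b))\<^sup>2)"
    using c S assms by (intro mult_left_mono member_le_sum) auto
  also have "\<dots> \<le> Re ?q"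
    by (simp add: inv_form_eq[OF y_def] sum_nonneg)
  finally have "Re ?q * (c * Re ?q) \<le> Re ?q * 1"
    by (simp add: power2_eq_square mult_ac)
  then show ?thesis
    using inv_form_nonneg[of "v k"] by (cases "Re ?q = 0") (auto simp: mult_le_cancel_left)
qed

text \<open>Taking the trace of \<open>M M^-1 = 1\<close> gives \<open>m\<close> as the trace of
  \<open>M^-1\<close> plus one scaled form for each row in \<open>S\<close>, each at most 1. So
  every row costs at most one degree of freedom.\<close>

lemma trace_inv_gram: "real CARD('m) - real (card S) \<le> Re (trace (matrix_inv (gram c v S)))"
proof -
  let ?B = "matrix_inv (gram c v S)"
  have "gram c v S ** ?B = mat 1" by (rule matrix_inv_right[OF inv])
  moreover have "(gram c v S *v column a ?B) $ a = (gram c v S ** ?B) $ a $ a" for a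
    by (simp add: matrix_vector_mult_def matrix_matrix_mult_def column_def)
  ultimately have "(gram c v S *v column a ?B) $ a = 1" for a
    by (simp add: mat_def)
  then have "of_nat CARD('m) = (\<Sum>a\<in>UNIV. (gram c v S *v column a ?B) $ a)" by simp
  also have "\<dots> = trace ?B + of_real c * (\<Sum>a\<in>UNIV. \<Sum>k\<in>S. \<Sum>b\<in>UNIV. cnj (v k $ a) * (v k $ b * ?B $ b $ a))"
    by (simp add: gram_mult_vec[OF S] sum.distrib trace_def column_def sum_distrib_left)
  also have "(\<Sum>a\<in>UNIV. \<Sum>k\<in>S. \<Sum>b\<in>UNIV. cnj (v k $ a) * (v k $ b * ?B $ b $ a)) =
      (\<Sum>k\<in>S. inv_form (gram c v S) (v k))"
  proof -
    have "(\<Sum>a\<in>UNIV. \<Sum>b\<in>UNIV. cnj (v k $ a) * (v k $ b * ?B $ b $ a)) =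
        inv_form (gram c v S) (v k)" for k
      unfolding inv_form_def matrix_vector_mult_def conj_vec_def
      by (subst sum.swap) (simp add: sum_distrib_left mult_ac)
    then show ?thesis by (subst sum.swap) simp
  qed
  finally have "Re (of_nat CARD('m)) = Re (trace ?B + of_real c * (\<Sum>k\<in>S. inv_form (gram c v S) (v k)))"
    by (rule arg_cong)
  then have "real CARD('m) = Re (trace ?B) + (\<Sum>k\<in>S. c * Re (inv_form (gram c v S) (v k)))"
    by (simp add: sum_distrib_left)
  moreover have "(\<Sum>k\<in>S. c * Re (inv_form (gram c v S) (v k))) \<le> (\<Sum>k\<in>S. 1)"
    by (intro sum_mono scaled_inv_form_row_le_1)
  ultimately show ?thesis by simp
qed

lemma cmat_adj_inv_gram: "cmat_adj (matrix_inv (gram c v S)) = matrix_inv (gram c v S)"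
proof -
  let ?B = "matrix_inv (gram c v S)"
  have "cmat_adj ?B ** gram c v S = mat 1"
    by (metis S cmat_adj_mat_1 cmat_adj_mult conj_transpose_gram inv matrix_inv_right)
  then show ?thesis
    by (metis inv matrix_inv_right matrix_mul_assoc matrix_mul_lid matrix_mul_rid)
qed

lemma det_gram_insert_aux:
  assumes "k \<notin> S"
  shows "det (gram c v (insert k S)) = det (gram c v S) * of_real (1 + c * Re (inv_form (gram c v S) (v k)))"
proof -
  have "of_real (Re (inv_form (gram c v S) (v k))) = inv_form (gram c v S) (v k)"
    using Im_inv_form[of "v k"] by (simp add: complex_eq_iff)
  then have "1 + of_real c * inv_form (gram c v S) (v k) =
      of_real (1 + c * Re (inv_form (gram c v S) (v k)))"
    by simp
  moreover have "(\<Sum>a\<in>UNIV. v k $ a * (matrix_inv (gram c v S) *v (of_real c *s conj_vec (v k))) $ a) =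
      of_real c * inv_form (gram c v S) (v k)"
    by (simp add: inv_form_def vector_scalar_commute sum_distrib_left mult_ac)
  ultimately show ?thesis
    by (simp only: gram_insert[OF S assms] det_rank_one_update[OF inv])
qed

end

text \<open>Starting from 1, every added row multiplies the determinant by a real factor at least 1.
  The induction also supplies the invertibility assumed so far.\<close>

lemma det_gram_ge_1:
  fixes v :: "'k \<Rightarrow> complex^'m::finite"
  assumes "finite S" and c: "c > 0"
  shows "Im (det (gram c v S)) = 0 \<and> 1 \<le> Re (det (gram c v S))"
  using assms(1)
proof (induction S rule: finite_induct)
  case (insert k S)
  then have "invertible (gram c v S)"
    by (auto simp: invertible_det_nz)
  from det_gram_insert_aux[OF insert(1) c this insert(2)] inv_form_nonneg[OF insert(1) c this, of "v k"]
  show ?case using insert.IH c by (auto intro!: mult_ge1_I simp: mult_ge1_I)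
qed simp

lemma invertible_gram:
  fixes v :: "'k \<Rightarrow> complex^'m::finite"
  assumes "finite S" "c > 0"
  shows "invertible (gram c v S)"
  using det_gram_ge_1[OF assms, of v] by (auto simp: invertible_det_nz)

lemma ln_det_gram_insert:
  fixes v :: "'k \<Rightarrow> complex^'m::finite"
  assumes "finite S" "c > 0" "k \<notin> S"
  shows "ln (Re (det (gram c v (insert k S)))) =
    ln (Re (det (gram c v S))) + ln (1 + c * Re (inv_form (gram c v S) (v k)))"
proof -
  note inv = invertible_gram[OF assms(1,2), of v]
  have "0 \<le> c * Re (inv_form (gram c v S) (v k))"
    using inv_form_nonneg[OF assms(1,2) inv] assms(2) by simp
  then have "1 + c * Re (inv_form (gram c v S) (v k)) > 0" by linarith
  then show ?thesis
    using det_gram_insert_aux[OF assms(1,2) inv assms(3)] det_gram_ge_1[OF assms(1,2), of v]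
    by (simp add: ln_mult)
qed

text \<open>An upper bound quadratic in the rows, from \<open>ln (1 + x) \<le> x\<close> and
  \<open>inv_form_le\<close>; it serves to prove integrability.\<close>

lemma ln_det_gram_le:
  fixes v :: "'k \<Rightarrow> complex^'m::finite"
  assumes "finite S" "c > 0"
  shows "ln (Re (det (gram c v S))) \<le> c * (\<Sum>k\<in>S. \<Sum>a\<in>UNIV. (cmod (v k $ a))\<^sup>2)"
  using assms(1)
proof (induction S rule: finite_induct)
  case (insert k S)
  note inv = invertible_gram[OF insert(1) assms(2), of v]
  have "ln (1 + c * Re (inv_form (gram c v S) (v k))) \<le> c * Re (inv_form (gram c v S) (v k))"
    using inv_form_nonneg[OF insert(1) assms(2) inv] assms(2) by (intro ln_add_one_self_le_self) simp
  also have "\<dots> \<le> c * (\<Sum>a\<in>UNIV. (cmod (v k $ a))\<^sup>2)"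
    using inv_form_le[OF insert(1) assms(2) inv] assms(2) by (intro mult_left_mono) auto
  finally show ?case
    using insert by (simp add: ln_det_gram_insert assms(2) distrib_left)
qed simp

section \<open>Expected log-determinants\<close>

lemma measurable_coordinate_PiM_PiM:
  assumes "k \<in> S"
  shows "(\<lambda>x. x k a) \<in> borel_measurable (PiM S (\<lambda>_. PiM UNIV (\<lambda>_. gaussian \<sigma>)))"
  using measurable_compose[OF measurable_component_singleton[OF assms, of "\<lambda>_. PiM UNIV (\<lambda>_. gaussian \<sigma>)"]
    measurable_component_singleton[of a UNIV "\<lambda>_. gaussian \<sigma>"]]
  by simp

text \<open>A row with constant mean \<open>z\<close> and imaginary noise. The original rows have
  \<open>z = 1\<close>; after rotation one row has \<open>z = sqrt n\<close> and the others
  \<open>z = 0\<close>.\<close>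

definition channel_row :: "complex \<Rightarrow> ('m \<Rightarrow> real) \<Rightarrow> complex^'m" where
  "channel_row z y = (\<chi> a. z + \<i> * complex_of_real (y a))"

lemma borel_measurable_det_gram:
  fixes x :: "'a \<Rightarrow> 'k \<Rightarrow> 'm::finite \<Rightarrow> real"
  assumes [measurable]: "\<And>k a. k \<in> S \<Longrightarrow> (\<lambda>\<omega>. x \<omega> k a) \<in> borel_measurable M" and "finite S"
  shows "(\<lambda>\<omega>. Re (det (gram c (\<lambda>k. channel_row (z k) (x \<omega> k)) S))) \<in> borel_measurable M"
proof -
  have "(\<lambda>\<omega>. gram c (\<lambda>k. channel_row (z k) (x \<omega> k)) S $ a $ b) \<in> borel_measurable M" for a b
    unfolding gram_def channel_row_def
    by simp
  then show ?thesis
    unfolding det_def by measurable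
qed

text \<open>The factors \<open>\<i>\<close> and its conjugate multiply to 1, and as \<open>y\<close>
  is real only the real parts of the entries of the inverse survive.\<close>

lemma inv_form_imaginary_row:
  fixes M :: "complex^'m::finite^'m"
  shows "Re (inv_form M (channel_row 0 y)) =
    (\<chi> a. y a) \<bullet> ((\<chi> a b. Re (matrix_inv M $ a $ b)) *v (\<chi> a. y a))"
  unfolding inv_form_def channel_row_def conj_vec_def matrix_vector_mult_def inner_vec_def
  by (simp add: sum_distrib_left sum_negf mult_ac)

context
  fixes c \<sigma> :: real
  assumes c: "c > 0" and \<sigma>: "\<sigma> > 0"
begin

lemma prob_space_row: "prob_space (PiM UNIV (\<lambda>_::'m::finite. gaussian \<sigma>))"
  by (rule prob_space_PiM) (simp add: prob_space_normal_density[OF \<sigma>])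

text \<open>The real part \<open>Q\<close> of the Hermitian inverse is symmetric, lies between 0 and
  1, and has trace at least \<open>m - card S\<close>, which becomes the number of degrees of
  freedom.\<close>

lemma nn_integral_ln_imaginary_row:
  fixes v :: "'k \<Rightarrow> complex^'m::finite"
  assumes S: "finite S" and card: "card S < CARD('m)"
  shows "ennreal (ln (1 + c * (2 * \<sigma>\<^sup>2 * exp (Digamma ((real CARD('m) - real (card S)) / 2))))) \<le>
    (\<integral>\<^sup>+y. ln (1 + c * Re (inv_form (gram c v S) (channel_row 0 y))) \<partial>PiM UNIV (\<lambda>_::'m. gaussian \<sigma>))"
proof -
  let ?B = "matrix_inv (gram c v S)"
  define Q :: "real^'m^'m" where "Q = (\<chi> a b. Re (?B $ a $ b))"
  note inv = invertible_gram[OF S c, of v]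
  have form: "Re (inv_form (gram c v S) (channel_row 0 y)) = (\<chi> a. y a) \<bullet> (Q *v (\<chi> a. y a))" for y
    by (simp add: inv_form_imaginary_row Q_def)
  have form': "x \<bullet> (Q *v x) = Re (inv_form (gram c v S) (channel_row 0 (($) x)))" for x
    by (simp add: form)
  have "cnj (?B $ b $ a) = ?B $ a $ b" for a b
    using cmat_adj_inv_gram[OF S c inv] by (simp add: cmat_adj_def vec_eq_iff)
  then have sym: "transpose Q = Q"
    by (simp add: Q_def transpose_def vec_eq_iff) (metis cnj.sel(1))
  have tr: "real CARD('m) - real (card S) \<le> trace Q"
    using trace_inv_gram[OF S c inv] by (simp add: Q_def trace_def)
  have "ennreal (ln (1 + c * (0 + 2 * \<sigma>\<^sup>2 * exp (Digamma ((real CARD('m) - real (card S)) / 2))))) \<le>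
    (\<integral>\<^sup>+y. ln (1 + c * (0 + (\<chi> a. y a) \<bullet> (Q *v (\<chi> a. y a)))) \<partial>PiM UNIV (\<lambda>_::'m. gaussian \<sigma>))"
  proof (rule nn_integral_ln_gaussian_quadratic_form[OF \<sigma> order_refl c _ tr sym])
    show "0 < real CARD('m) - real (card S)" using card by simp
    show "0 \<le> x \<bullet> (Q *v x)" for x
      unfolding form' by (rule inv_form_nonneg[OF S c inv])
    show "x \<bullet> (Q *v x) \<le> x \<bullet> x" for x
      using inv_form_le[OF S c inv, of "channel_row 0 (($) x)"]
      unfolding form' by (simp add: channel_row_def norm_mult inner_vec_def power2_eq_square)
  qed
  then show ?thesis by (simp add: form)
qed

text \<open>Before any row is present the inverse is the identity, so all \<open>m\<close> degrees
  of freedom are available; \<open>b\<close> will hold the contribution of the mean.\<close>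

lemma nn_integral_ln_first_row:
  assumes "b \<ge> 0"
  shows "ennreal (ln (1 + c * (b + 2 * \<sigma>\<^sup>2 * exp (Digamma (real CARD('m) / 2))))) \<le>
    (\<integral>\<^sup>+y. ln (1 + c * (b + (\<Sum>a\<in>UNIV. (y a)\<^sup>2))) \<partial>PiM UNIV (\<lambda>_::'m::finite. gaussian \<sigma>))"
proof -
  have "ennreal (ln (1 + c * (b + 2 * \<sigma>\<^sup>2 * exp (Digamma (real CARD('m) / 2))))) \<le>
    (\<integral>\<^sup>+y. ln (1 + c * (b + (\<chi> a. y a) \<bullet> ((mat 1 :: real^'m^'m) *v (\<chi> a. y a)))) \<partial>PiM UNIV (\<lambda>_::'m. gaussian \<sigma>))"
    by (rule nn_integral_ln_gaussian_quadratic_form[OF \<sigma> assms c])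
       (simp_all add: trace_I transpose_mat)
  then show ?thesis by (simp add: inner_vec_def power2_eq_square)
qed

text \<open>Row \<open>k0\<close> comes first: against the identity matrix its real mean and
  imaginary noise contribute separately, as \<open>m z^2\<close> plus the squared noise. Each
  further row has mean zero and, for fixed earlier rows, contributes at least its own
  summand.\<close>

lemma nn_integral_ln_det_gram_ge:
  fixes z :: real and k0 :: "'k"
  assumes "finite T" "k0 \<notin> T" "card T < CARD('m::finite)"
  shows "ennreal (ln (1 + c * (real CARD('m) * z\<^sup>2 + 2 * \<sigma>\<^sup>2 * exp (Digamma (real CARD('m) / 2)))) +
      (\<Sum>i=1..card T. ln (1 + c * (2 * \<sigma>\<^sup>2 * exp (Digamma ((real CARD('m) - real i) / 2))))))
    \<le> (\<integral>\<^sup>+x. ln (Re (det (gram c (\<lambda>k. channel_row (if k = k0 then of_real z else 0) (x k)) (insert k0 T))))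
        \<partial>PiM (insert k0 T) (\<lambda>_. PiM UNIV (\<lambda>_::'m. gaussian \<sigma>)))"
    (is "ennreal (?A T) \<le> ?I T")
  using assms
proof (induction T rule: finite_induct)
  let ?R = "PiM UNIV (\<lambda>_::'m. gaussian \<sigma>)"
  interpret R: prob_space ?R by (rule prob_space_row)
  interpret product_sigma_finite "\<lambda>_::'k. ?R"
    by (simp add: product_sigma_finite_def R.sigma_finite_measure_axioms)
  case empty
  have "(\<Sum>a\<in>UNIV. (cmod (channel_row (of_real z) y $ a))\<^sup>2) = real CARD('m) * z\<^sup>2 + (\<Sum>a\<in>UNIV. (y a)\<^sup>2)"
    for y :: "'m \<Rightarrow> real"
    by (simp add: channel_row_def cmod_power2 sum.distrib)
  moreover have "Re (inv_form (mat 1) w) = (\<Sum>a\<in>UNIV. (cmod (w $ a))\<^sup>2)" for w :: "complex^'m"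
  proof -
    have "matrix_inv (mat 1) = (mat 1 :: complex^'m^'m)"
      using matrix_inv_right[of "mat 1 :: complex^'m^'m"] by (simp add: invertible_det_nz)
    then show ?thesis
      by (simp add: inv_form_def conj_vec_def cmod_power2 flip: power2_eq_square)
  qed
  ultimately have "ln (Re (det (gram c (\<lambda>k. channel_row (if k = k0 then of_real z else 0) (x k)) {k0}))) =
      ln (1 + c * (real CARD('m) * z\<^sup>2 + (\<Sum>a\<in>UNIV. (x k0 a)\<^sup>2)))" for x :: "'k \<Rightarrow> 'm \<Rightarrow> real"
    using ln_det_gram_insert[of "{}" c k0 "\<lambda>k. channel_row (if k = k0 then of_real z else 0) (x k)"] c
    by simp
  moreover have "(\<integral>\<^sup>+x. ln (1 + c * (real CARD('m) * z\<^sup>2 + (\<Sum>a\<in>UNIV. (x k0 a)\<^sup>2))) \<partial>PiM {k0} (\<lambda>_. ?R)) =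
      (\<integral>\<^sup>+y. ln (1 + c * (real CARD('m) * z\<^sup>2 + (\<Sum>a\<in>UNIV. (y a)\<^sup>2))) \<partial>?R)"
    by (rule product_nn_integral_singleton) measurable
  ultimately show ?case
    using nn_integral_ln_first_row[of "real CARD('m) * z\<^sup>2"] by simp
next
  let ?R = "PiM UNIV (\<lambda>_::'m. gaussian \<sigma>)"
  interpret R: prob_space ?R by (rule prob_space_row)
  interpret product_sigma_finite "\<lambda>_::'k. ?R"
    by (simp add: product_sigma_finite_def R.sigma_finite_measure_axioms)
  case (insert k T)
  let ?S = "insert k0 T"
  let ?v = "\<lambda>x k. channel_row (if k = k0 then of_real z else 0) (x k)"
  \<comment> \<open>Counting \<open>k0\<close>, there are \<open>card T + 1\<close> earlier rows,
    which is the index of the new last summand.\<close>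
  let ?K = "ln (1 + c * (2 * \<sigma>\<^sup>2 * exp (Digamma ((real CARD('m) - real (card ?S)) / 2))))"
  have S: "finite ?S" "k \<notin> ?S" "card ?S < CARD('m)" "k \<noteq> k0"
    using insert by auto
  have [measurable]: "(\<lambda>x. Re (det (gram c (?v x) U))) \<in> borel_measurable (PiM U (\<lambda>_. ?R))" if "finite U" for U
    by (intro borel_measurable_det_gram measurable_coordinate_PiM_PiM that)
  \<comment> \<open>The Gram matrix of the earlier rows does not see the new row \<open>y\<close>,
    so the new term may be integrated over \<open>y\<close> with \<open>x\<close> fixed.\<close>
  have split: "ln (Re (det (gram c (?v (x(k := y))) (insert k ?S)))) =
      ln (Re (det (gram c (?v x) ?S))) + ln (1 + c * Re (inv_form (gram c (?v x) ?S) (channel_row 0 y)))"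
    for x y
  proof -
    have "gram c (?v (x(k := y))) ?S = gram c (?v x) ?S"
      by (rule gram_cong) (use S in auto)
    then show ?thesis
      using ln_det_gram_insert[OF S(1) c S(2), of "?v (x(k := y))"] S(4) by simp
  qed
  have nonneg: "0 \<le> ln (Re (det (gram c (?v x) ?S)))"
    "0 \<le> ln (1 + c * Re (inv_form (gram c (?v x) ?S) (channel_row 0 y)))" for x y
    using det_gram_ge_1[OF S(1) c, of "?v x"] c
      inv_form_nonneg[OF S(1) c invertible_gram[OF S(1) c], of "?v x"] by auto
  have [measurable]: "(\<lambda>y. Re (inv_form (gram c (?v x) ?S) (channel_row 0 y))) \<in> borel_measurable ?R" for x
  proof -
    have [measurable]: "(\<lambda>y. y a) \<in> borel_measurable ?R" for a
      using measurable_component_singleton[of a UNIV "\<lambda>_::'m. gaussian \<sigma>"] by simp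
    show ?thesis
      unfolding inv_form_imaginary_row inner_vec_def matrix_vector_mult_def vec_lambda_beta
      by measurable
  qed
  have "ennreal (?A (insert k T)) = ennreal (?A T + ?K)"
    using insert by (simp add: add.assoc)
  also have "\<dots> = ennreal (?A T) + ennreal ?K"
    using c by (intro ennreal_plus add_nonneg_nonneg sum_nonneg ln_ge_zero) auto
  also have "\<dots> \<le> ?I T + ennreal ?K"
    using insert by (intro add_right_mono) auto
  also have "\<dots> = (\<integral>\<^sup>+x. ennreal (ln (Re (det (gram c (?v x) ?S)))) + ennreal ?K \<partial>PiM ?S (\<lambda>_. ?R))"
  proof -
    interpret P: prob_space "PiM ?S (\<lambda>_. ?R)" by (rule prob_space_PiM) (rule prob_space_row)
    show ?thesis using S by (subst nn_integral_add) (auto simp: P.emeasure_space_1)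
  qed
  also have "\<dots> \<le> (\<integral>\<^sup>+x. (\<integral>\<^sup>+y. ln (Re (det (gram c (?v (x(k := y))) (insert k ?S)))) \<partial>?R) \<partial>PiM ?S (\<lambda>_. ?R))"
  proof (rule nn_integral_mono)
    fix x
    have "ennreal (ln (Re (det (gram c (?v x) ?S)))) + ennreal ?K \<le> ennreal (ln (Re (det (gram c (?v x) ?S)))) +
      (\<integral>\<^sup>+y. ln (1 + c * Re (inv_form (gram c (?v x) ?S) (channel_row 0 y))) \<partial>?R)"
      by (intro add_left_mono nn_integral_ln_imaginary_row S)
    also have "\<dots> = (\<integral>\<^sup>+y. ennreal (ln (Re (det (gram c (?v x) ?S)))) +
      ennreal (ln (1 + c * Re (inv_form (gram c (?v x) ?S) (channel_row 0 y)))) \<partial>?R)"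
      by (simp add: nn_integral_add R.emeasure_space_1)
    also have "\<dots> = (\<integral>\<^sup>+y. ln (Re (det (gram c (?v (x(k := y))) (insert k ?S)))) \<partial>?R)"
      unfolding split by (simp add: nonneg)
    finally show "ennreal (ln (Re (det (gram c (?v x) ?S)))) + ennreal ?K \<le>
      (\<integral>\<^sup>+y. ln (Re (det (gram c (?v (x(k := y))) (insert k ?S)))) \<partial>?R)" .
  qed
  also have "\<dots> = (\<integral>\<^sup>+x. ln (Re (det (gram c (?v x) (insert k ?S)))) \<partial>PiM (insert k ?S) (\<lambda>_. ?R))"
    using S by (intro product_nn_integral_insert[symmetric]) auto
  finally show ?case
    by (simp add: insert_commute)
qed

end

section \<open>Concentrating the all-ones matrix in one row\<close>

text \<open>Replacing \<open>V\<close> by \<open>U V\<close> does not change \<open>V^H V\<close>.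
  The rotated rows have as means the row sums of \<open>U\<close>.\<close>

lemma gram_rotated_rows:
  fixes U :: "real^'n::finite^'n" and y :: "'n \<Rightarrow> 'm::finite \<Rightarrow> real"
  assumes U: "orthogonal_matrix U"
  shows "gram c (\<lambda>k. channel_row (of_real (\<Sum>j\<in>UNIV. U $ k $ j)) (\<lambda>a. \<Sum>j\<in>UNIV. U $ k $ j * y j a)) UNIV =
    gram c (\<lambda>k. channel_row 1 (y k)) UNIV"
proof -
  have UU: "(\<Sum>k\<in>UNIV. U $ k $ i * U $ k $ j) = (if i = j then 1 else 0)" for i j
  proof -
    have "(transpose U ** U) $ i $ j = mat 1 $ i $ j"
      using U by (simp add: orthogonal_matrix_def)
    then show ?thesis by (simp add: matrix_matrix_mult_def transpose_def mat_def)
  qed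
  let ?w = "\<lambda>j. channel_row 1 (y j)"
  have row: "channel_row (of_real (\<Sum>j\<in>UNIV. U $ k $ j)) (\<lambda>a. \<Sum>j\<in>UNIV. U $ k $ j * y j a) $ a =
      (\<Sum>j\<in>UNIV. of_real (U $ k $ j) * ?w j $ a)" for k a
    by (simp add: channel_row_def distrib_left sum.distrib sum_distrib_left mult_ac)
  have "(\<Sum>k\<in>UNIV. cnj (\<Sum>i\<in>UNIV. of_real (U $ k $ i) * ?w i $ a) * (\<Sum>j\<in>UNIV. of_real (U $ k $ j) * ?w j $ b)) =
    (\<Sum>k\<in>UNIV. cnj (?w k $ a) * ?w k $ b)" for a b
  proof -
    have "(\<Sum>k\<in>UNIV. cnj (\<Sum>i\<in>UNIV. of_real (U $ k $ i) * ?w i $ a) * (\<Sum>j\<in>UNIV. of_real (U $ k $ j) * ?w j $ b)) =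
      (\<Sum>k\<in>UNIV. \<Sum>i\<in>UNIV. \<Sum>j\<in>UNIV. of_real (U $ k $ i * U $ k $ j) * (cnj (?w i $ a) * ?w j $ b))"
      unfolding cnj_sum sum_product by (intro sum.cong refl) (simp add: mult_ac)
    also have "\<dots> = (\<Sum>i\<in>UNIV. \<Sum>k\<in>UNIV. \<Sum>j\<in>UNIV. of_real (U $ k $ i * U $ k $ j) * (cnj (?w i $ a) * ?w j $ b))"
      by (rule sum.swap)
    also have "\<dots> = (\<Sum>i\<in>UNIV. \<Sum>j\<in>UNIV. \<Sum>k\<in>UNIV. of_real (U $ k $ i * U $ k $ j) * (cnj (?w i $ a) * ?w j $ b))"
      by (intro sum.cong refl sum.swap)
    also have "\<dots> = (\<Sum>i\<in>UNIV. \<Sum>j\<in>UNIV. of_real (if i = j then 1 else 0) * (cnj (?w i $ a) * ?w j $ b))"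
      by (simp only: sum_distrib_right[symmetric] of_real_sum[symmetric] UU)
    also have "\<dots> = (\<Sum>i\<in>UNIV. \<Sum>j\<in>UNIV. if i = j then cnj (?w i $ a) * ?w j $ b else 0)"
      by (intro sum.cong refl) auto
    finally show ?thesis by simp
  qed
  then show ?thesis
    unfolding gram_def row by simp
qed

lemma nn_integral_uncurry_gaussian:
  fixes e :: "'k \<Rightarrow> 'n::finite \<times> 'm::finite"
  assumes \<sigma>: "\<sigma> > 0" and e: "bij e"
    and f[measurable]: "f \<in> borel_measurable (PiM UNIV (\<lambda>_. borel))"
  shows "(\<integral>\<^sup>+\<Phi>. f \<Phi> \<partial>PiM UNIV (\<lambda>_::'k. gaussian \<sigma>)) =
    (\<integral>\<^sup>+x. f (\<lambda>k. x (fst (e k)) (snd (e k))) \<partial>PiM UNIV (\<lambda>_::'n. PiM UNIV (\<lambda>_::'m. gaussian \<sigma>)))"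
proof -
  have [measurable]: "(\<lambda>x k. x (fst (e k)) (snd (e k))) \<in>
      PiM UNIV (\<lambda>_::'n. PiM UNIV (\<lambda>_::'m. gaussian \<sigma>)) \<rightarrow>\<^sub>M PiM UNIV (\<lambda>_::'k. gaussian \<sigma>)"
    by (rule measurable_PiM_single') (auto simp: space_PiM intro!: measurable_coordinate_PiM_PiM)
  have [measurable]: "f \<in> borel_measurable (PiM UNIV (\<lambda>_::'k. gaussian \<sigma>))"
    using f by (simp cong: measurable_cong_sets add: sets_PiM_borel_cong)
  show ?thesis
    by (subst distr_uncurry_PiM[OF prob_space_normal_density[OF \<sigma>] e, symmetric])
       (simp add: nn_integral_distr)
qed

context
  fixes c \<sigma> :: real
  assumes c: "c > 0" and \<sigma>: "\<sigma> > 0"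
begin

text \<open>A rotation with the normalized all-ones vector as row \<open>k0\<close> sends the means
  to \<open>sqrt n\<close> in that row and 0 elsewhere, which produces the term \<open>m n\<close>
  for \<open>i = 0\<close> only.\<close>

lemma nn_integral_ln_det_channel_ge_canonical:
  assumes le: "CARD('n::finite) \<le> CARD('m::finite)"
  shows "ennreal (\<Sum>i<CARD('n). ln (1 + c * (real CARD('m) * real CARD('n) * (if i = 0 then 1 else 0)
      + 2 * \<sigma>\<^sup>2 * exp (Digamma ((real CARD('m) - real i) / 2)))))
    \<le> (\<integral>\<^sup>+\<Phi>. ln (Re (det (gram c (\<lambda>k. channel_row 1 (\<lambda>a. \<Phi> (k, a))) UNIV)))
        \<partial>PiM UNIV (\<lambda>_::'n \<times> 'm. gaussian \<sigma>))"
proof -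
  obtain k0 :: 'n where True by simp
  define z where "z = sqrt (real CARD('n))"
  have z: "z > 0" "z\<^sup>2 = real CARD('n)" by (simp_all add: z_def)
  have "norm ((\<chi> j. 1 / z) :: real^'n) = 1"
    using z by (simp add: norm_vec_def L2_set_def power_divide)
  \<comment> \<open>Column \<open>k0\<close> of \<open>A\<close> is the normalized all-ones vector,
    so it is row \<open>k0\<close> of the transpose \<open>U\<close>; orthogonality makes the other
    rows of \<open>U\<close> sum to 0.\<close>
  then obtain A where A: "orthogonal_matrix A" "A *v axis k0 1 = ((\<chi> j. 1 / z) :: real^'n)"
    by (rule orthogonal_matrix_exists_basis)
  define U where "U = transpose A"
  have U: "orthogonal_matrix U"
    using A(1) by (simp add: U_def orthogonal_matrix_transpose)
  have sumU: "(\<Sum>j\<in>UNIV. U $ k $ j) = (if k = k0 then z else 0)" for k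
  proof -
    have "U *v (\<chi> j. 1 / z) = axis k0 1"
      using A by (metis U_def matrix_vector_mul_assoc matrix_vector_mul_lid orthogonal_matrix_def)
    then have "(\<Sum>j\<in>UNIV. U $ k $ j / z) = (if k = k0 then 1 else 0)"
      by (simp add: vec_eq_iff matrix_vector_mult_def axis_def)
    then show ?thesis using z by (simp add: divide_eq_eq split: if_splits flip: sum_divide_distrib)
  qed
  \<comment> \<open>The Kronecker product of \<open>U\<close> with the identity: it applies
    \<open>U\<close> to each column of the noise, viewed as one long vector.\<close>
  define V :: "real^('n \<times> 'm)^('n \<times> 'm)" where
    "V = (\<chi> p q. if snd p = snd q then U $ fst p $ fst q else 0)"
  have V: "orthogonal_matrix V"
  proof -
    have "(transpose V ** V) $ p $ q = mat 1 $ p $ q" for p q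
    proof -
      have "(\<Sum>k\<in>UNIV. U $ k $ fst p * U $ k $ fst q) = (transpose U ** U) $ fst p $ fst q"
        by (simp add: matrix_matrix_mult_def transpose_def)
      also have "\<dots> = (if fst p = fst q then 1 else 0)"
        using U by (simp add: orthogonal_matrix_def mat_def)
      finally have *: "(\<Sum>k\<in>UNIV. U $ k $ fst p * U $ k $ fst q) = (if fst p = fst q then 1 else 0)" .
      have "(transpose V ** V) $ p $ q = (\<Sum>r\<in>UNIV. V $ r $ p * V $ r $ q)"
        by (simp add: matrix_matrix_mult_def transpose_def)
      also have "\<dots> = (\<Sum>k\<in>UNIV. \<Sum>a\<in>UNIV. V $ (k, a) $ p * V $ (k, a) $ q)"
        by (simp add: sum.cartesian_product)
      also have "\<dots> = (\<Sum>k\<in>UNIV. \<Sum>a\<in>UNIV. if a = snd p then (if snd p = snd q then U $ k $ fst p * U $ k $ fst q else 0) else 0)"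
        by (intro sum.cong refl) (auto simp: V_def)
      also have "\<dots> = mat 1 $ p $ q"
        using * by (cases "snd p = snd q") (auto simp: mat_def prod_eq_iff)
      finally show ?thesis .
    qed
    then show ?thesis by (simp add: orthogonal_matrix vec_eq_iff)
  qed
  let ?f = "\<lambda>\<Phi>. ennreal (ln (Re (det (gram c (\<lambda>k. channel_row (if k = k0 then of_real z else 0) (\<lambda>a. \<Phi> (k, a))) UNIV))))"
  have [measurable]: "?f \<in> borel_measurable (PiM UNIV (\<lambda>_::'n \<times> 'm. borel))"
    by (intro measurable_compose[OF _ measurable_ennreal] borel_measurable_ln borel_measurable_det_gram) auto
  have rot: "?f (\<lambda>p. \<Sum>q\<in>UNIV. V $ p $ q * \<Phi> q) =
      ennreal (ln (Re (det (gram c (\<lambda>k. channel_row 1 (\<lambda>a. \<Phi> (k, a))) UNIV))))" for \<Phi>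
  proof -
    have "(\<Sum>q\<in>UNIV. V $ (k, a) $ q * \<Phi> q) = (\<Sum>j\<in>UNIV. U $ k $ j * \<Phi> (j, a))" for k a
    proof -
      have "(\<Sum>q\<in>UNIV. V $ (k, a) $ q * \<Phi> q) = (\<Sum>j\<in>UNIV. \<Sum>b\<in>UNIV. V $ (k, a) $ (j, b) * \<Phi> (j, b))"
        by (simp add: sum.cartesian_product)
      also have "\<dots> = (\<Sum>j\<in>UNIV. \<Sum>b\<in>UNIV. if b = a then U $ k $ j * \<Phi> (j, a) else 0)"
        by (intro sum.cong refl) (auto simp: V_def)
      finally show ?thesis by simp
    qed
    then show ?thesis
      using gram_rotated_rows[OF U, of c "\<lambda>j a. \<Phi> (j, a)"] by (simp add: sumU if_distrib cong: if_cong)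
  qed
  let ?T = "UNIV - {k0}"
  have cT: "card ?T = CARD('n) - 1" by simp
  have "CARD('n) - 1 < CARD('n)" by (rule diff_less) auto
  then have "card ?T < CARD('m)"
    unfolding cT using le by (rule less_le_trans)
  then have T: "finite ?T" "k0 \<notin> ?T" "card ?T < CARD('m)" by simp_all
  have "(\<Sum>i<CARD('n). ln (1 + c * (real CARD('m) * real CARD('n) * (if i = 0 then 1 else 0)
      + 2 * \<sigma>\<^sup>2 * exp (Digamma ((real CARD('m) - real i) / 2))))) =
    ln (1 + c * (real CARD('m) * z\<^sup>2 + 2 * \<sigma>\<^sup>2 * exp (Digamma (real CARD('m) / 2)))) +
      (\<Sum>i=1..card ?T. ln (1 + c * (2 * \<sigma>\<^sup>2 * exp (Digamma ((real CARD('m) - real i) / 2)))))"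
  proof -
    \<comment> \<open>Index 0 belongs to row \<open>k0\<close>, indices 1 to \<open>n - 1\<close> to
      the remaining rows.\<close>
    have "{..<CARD('n)} = insert 0 {1..card ?T}"
      unfolding cT by (auto simp: Suc_le_eq)
    then show ?thesis by (simp add: z)
  qed
  then have "ennreal (\<Sum>i<CARD('n). ln (1 + c * (real CARD('m) * real CARD('n) * (if i = 0 then 1 else 0)
      + 2 * \<sigma>\<^sup>2 * exp (Digamma ((real CARD('m) - real i) / 2))))) \<le>
    (\<integral>\<^sup>+x. ?f (\<lambda>p. x (fst p) (snd p)) \<partial>PiM UNIV (\<lambda>_::'n. PiM UNIV (\<lambda>_::'m. gaussian \<sigma>)))"
    using nn_integral_ln_det_gram_ge[OF c \<sigma> T, of z] by (simp add: insert_UNIV)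
  also have "\<dots> = (\<integral>\<^sup>+\<Phi>. ?f \<Phi> \<partial>PiM UNIV (\<lambda>_::'n \<times> 'm. gaussian \<sigma>))"
    using nn_integral_uncurry_gaussian[OF \<sigma>, of "\<lambda>p::'n \<times> 'm. p" ?f] by (simp flip: id_def)
  also have "\<dots> = (\<integral>\<^sup>+\<Phi>. ?f (\<lambda>p. \<Sum>q\<in>UNIV. V $ p $ q * \<Phi> q) \<partial>PiM UNIV (\<lambda>_::'n \<times> 'm. gaussian \<sigma>))"
    by (rule nn_integral_PiM_gaussian_orthogonal[OF \<sigma> V, symmetric]) measurable
  finally show ?thesis unfolding rot .
qed

text \<open>Passes to the Bochner integral, whose default value 0 on non-integrable functions would
  break the bound; integrability is therefore established first.\<close>

lemma integral_ln_det_channel_ge: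
  fixes e :: "'k \<Rightarrow> 'n::finite \<times> 'm::finite"
  assumes le: "CARD('n) \<le> CARD('m)" and e: "bij e"
  shows "(\<Sum>i<CARD('n). ln (1 + c * (real CARD('m) * real CARD('n) * (if i = 0 then 1 else 0)
      + 2 * \<sigma>\<^sup>2 * exp (Digamma ((real CARD('m) - real i) / 2)))))
    \<le> (\<integral>\<Phi>. ln (Re (det (gram c (\<lambda>k. channel_row 1 (\<lambda>a. \<Phi> (inv e (k, a)))) UNIV)))
        \<partial>PiM UNIV (\<lambda>_::'k. gaussian \<sigma>))"
    (is "?s \<le> integral\<^sup>L ?M ?F")
proof -
  have fin: "finite (UNIV :: 'k set)" using e by (metis bij_betw_finite finite)
  let ?G = "\<lambda>\<Psi> :: 'n \<times> 'm \<Rightarrow> real. ln (Re (det (gram c (\<lambda>k. channel_row 1 (\<lambda>a. \<Psi> (k, a))) UNIV)))"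
  have meas: "(\<lambda>\<Phi>. ?G (\<lambda>p. \<Phi> (d p))) \<in> borel_measurable (PiM UNIV (\<lambda>_::'i. borel))"
    for d :: "'n \<times> 'm \<Rightarrow> 'i"
    by (intro borel_measurable_ln borel_measurable_det_gram) auto
  have F[measurable]: "?F \<in> borel_measurable ?M"
    using meas[of "inv e"] by (simp cong: measurable_cong_sets add: sets_PiM_borel_cong)
  have nn: "0 \<le> ?F \<Phi>" for \<Phi>
    by (intro ln_ge_zero conjunct2[OF det_gram_ge_1]) (auto simp: c)
  have "(\<integral>\<^sup>+\<Phi>. ennreal (?F \<Phi>) \<partial>?M) =
      (\<integral>\<^sup>+x. ennreal (?G (\<lambda>p. x (fst p) (snd p))) \<partial>PiM UNIV (\<lambda>_::'n. PiM UNIV (\<lambda>_::'m. gaussian \<sigma>)))"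
    using nn_integral_uncurry_gaussian[OF \<sigma> e, of "\<lambda>\<Phi>. ennreal (?F \<Phi>)"] meas[of "inv e"] e
    by (simp add: bij_is_surj surj_f_inv_f)
  also have "\<dots> = (\<integral>\<^sup>+\<Psi>. ennreal (?G \<Psi>) \<partial>PiM UNIV (\<lambda>_::'n \<times> 'm. gaussian \<sigma>))"
    using nn_integral_uncurry_gaussian[OF \<sigma>, of "\<lambda>p::'n \<times> 'm. p" "\<lambda>\<Psi>. ennreal (?G \<Psi>)"] meas[of "\<lambda>p. p"]
    by (simp flip: id_def)
  finally have ge: "ennreal ?s \<le> (\<integral>\<^sup>+\<Phi>. ennreal (?F \<Phi>) \<partial>?M)"
    using nn_integral_ln_det_channel_ge_canonical[OF le] by simp
  interpret G: prob_space "gaussian \<sigma>" using \<sigma> by (rule prob_space_normal_density)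
  interpret prob_space ?M by (rule prob_space_PiM) (simp add: G.prob_space_axioms)
  have sq: "integrable ?M (\<lambda>\<Phi>. (\<Phi> p)\<^sup>2)" for p
  proof -
    have "integrable (gaussian \<sigma>) (\<lambda>x. x\<^sup>2)"
      using integrable_normal_moment[OF \<sigma>, of 0 2] by (subst integrable_density) auto
    then have "integrable (distr ?M (gaussian \<sigma>) (\<lambda>\<Phi>. \<Phi> p)) (\<lambda>x. x\<^sup>2)"
      by (subst distr_PiM_component) (auto simp: G.prob_space_axioms)
    then show ?thesis
      by (subst (asm) integrable_distr_eq) auto
  qed
  have "integrable ?M ?F"
  proof (rule Bochner_Integration.integrable_bound)
    \<comment> \<open>The quadratic bound on the log-determinant, since an entry
      \<open>1 + \<i> x\<close> has squared modulus \<open>1 + x^2\<close>; Gaussian second moments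
      are finite.\<close>
    let ?B = "\<lambda>\<Phi>. c * (\<Sum>k\<in>UNIV. \<Sum>a\<in>UNIV. 1 + (\<Phi> (inv e (k, a)))\<^sup>2)"
    show "integrable ?M ?B" using sq by auto
    have "?F \<Phi> \<le> ?B \<Phi>" for \<Phi>
      using ln_det_gram_le[OF _ c, where S = UNIV and v = "\<lambda>k. channel_row 1 (\<lambda>a. \<Phi> (inv e (k, a)))"]
      by (simp add: channel_row_def cmod_power2)
    then show "AE \<Phi> in ?M. norm (?F \<Phi>) \<le> norm (?B \<Phi>)"
      using nn by (intro AE_I2) (smt (verit) real_norm_def)
  qed measurable
  then have "(\<integral>\<^sup>+\<Phi>. ennreal (?F \<Phi>) \<partial>?M) = ennreal (integral\<^sup>L ?M ?F)"
    using nn by (intro nn_integral_eq_integral) auto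
  with ge have "ennreal ?s \<le> ennreal (integral\<^sup>L ?M ?F)" by simp
  then show ?thesis
    by (subst (asm) ennreal_le_iff) (auto intro!: Bochner_Integration.integral_nonneg nn)
qed

end

section \<open>Cancelling the phases of the channel\<close>

text \<open>\<open>P = D M D^H\<close> for a diagonal unitary \<open>D\<close>, whose determinant
  cancels against its conjugate.\<close>

lemma det_unimodular_scaling:
  fixes M P :: "complex^'m::finite^'m"
  assumes x: "\<And>a. cmod (x a) = 1" and P: "\<And>a b. P $ a $ b = x a * M $ a $ b * cnj (x b)"
  shows "det P = det M"
proof -
  have "P = (\<chi> a. x a *s (transpose (\<chi> b. cnj (x b) *s column b M)) $ a)"
    by (simp add: vec_eq_iff P transpose_def column_def mult_ac)
  then have "det P = prod x UNIV * det (transpose (\<chi> b. cnj (x b) *s column b M))"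
    by (simp only: det_rows_mul) (simp add: vec_lambda_eta)
  also have "\<dots> = prod x UNIV * (prod (\<lambda>b. cnj (x b)) UNIV * det (transpose M))"
  proof -
    have "(\<chi> b. column b M) = transpose M"
      by (simp add: vec_eq_iff transpose_def column_def)
    then show ?thesis by (simp only: det_transpose det_rows_mul)
  qed
  also have "\<dots> = prod (\<lambda>a. x a * cnj (x a)) UNIV * det M"
    by (simp add: prod.distrib mult.assoc)
  also have "prod (\<lambda>a. x a * cnj (x a)) UNIV = 1"
    by (intro prod.neutral) (simp add: x flip: complex_norm_square)
  finally show ?thesis by simp
qed

lemma scaleR_mult: "r *\<^sub>R (A ** B) = (r *\<^sub>R A) ** B"
  for A :: "complex^'m::finite^'n::finite" and B :: "complex^'k::finite^'m"
  by (simp add: vec_eq_iff matrix_matrix_mult_def scaleR_sum_right)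

text \<open>Sylvester's identity replaces \<open>H H^H\<close> by \<open>H^H H\<close>, the Gram
  matrix of the rows. The phases of \<open>g\<close> cancel inside each entry, those of
  \<open>h\<close> by unimodular scaling.\<close>

lemma inst_rate_eq_gram_rows:
  fixes g :: "complex^'r::finite" and h :: "complex^'t::finite"
  assumes g: "\<And>i. cmod (g $ i) = 1" and h: "\<And>j. cmod (h $ j) = 1"
  shows "inst_rate \<rho> (noisy_channel g h \<Phi>) =
    log 2 (Re (det (gram (\<rho> / real CARD('t)) (\<lambda>k. channel_row 1 (\<lambda>a. \<Phi> (k, a))) UNIV)))"
proof -
  let ?c = "\<rho> / real CARD('t)"
  let ?A = "noisy_channel g h \<Phi>"
  have "det (mat 1 + ?c *\<^sub>R (?A ** cmat_adj ?A)) = det (mat 1 + (?c *\<^sub>R ?A) ** cmat_adj ?A)"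
    by (simp add: scaleR_mult)
  also have "\<dots> = det (mat 1 + cmat_adj ?A ** (?c *\<^sub>R ?A))"
    by (rule sylvester_determinant)
  also have "\<dots> = det (gram ?c (\<lambda>k. channel_row 1 (\<lambda>a. \<Phi> (k, a))) UNIV)"
  proof (rule det_unimodular_scaling)
    show "cmod (cnj (h $ a)) = 1" for a using h by simp
    fix a b
    let ?w = "\<lambda>k. channel_row 1 (\<lambda>a. \<Phi> (k, a))"
    have "cnj (?A $ k $ a) * ?A $ k $ b = cnj (h $ a) * (cnj (?w k $ a) * ?w k $ b) * h $ b" for k
    proof -
      have "g $ k * cnj (g $ k) = 1" using g by (simp flip: complex_norm_square)
      then show ?thesis
        by (simp add: noisy_channel_def hadamard_def los_channel_def channel_row_def) (simp add: algebra_simps)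
    qed
    then have "(cmat_adj ?A ** (?c *\<^sub>R ?A)) $ a $ b =
        (\<Sum>k\<in>UNIV. of_real ?c * (cnj (h $ a) * (cnj (?w k $ a) * ?w k $ b) * h $ b))"
      by (simp only: matrix_matrix_mult_def cmat_adj_def vec_lambda_beta vector_scaleR_component
          scaleR_conv_of_real[where 'a = complex] mult.left_commute)
    also have "\<dots> = cnj (h $ a) * (of_real ?c * (\<Sum>k\<in>UNIV. cnj (?w k $ a) * ?w k $ b)) * h $ b"
      by (simp add: sum_distrib_left sum_distrib_right mult_ac)
    finally show "(mat 1 + cmat_adj ?A ** (?c *\<^sub>R ?A)) $ a $ b =
        cnj (h $ a) * gram ?c ?w UNIV $ a $ b * cnj (cnj (h $ b))"
      using h[of b] by (simp add: gram_def mat_def algebra_simps flip: complex_norm_square)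
  qed
  finally show ?thesis by (simp add: inst_rate_def)
qed

text \<open>In \<open>H H^H\<close> the phases of \<open>h\<close> cancel inside each entry and
  those of \<open>g\<close> by scaling. The conjugate falls on the second index, so what remains is
  the transpose of the Gram matrix of the columns.\<close>

lemma inst_rate_eq_gram_columns:
  fixes g :: "complex^'r::finite" and h :: "complex^'t::finite"
  assumes g: "\<And>i. cmod (g $ i) = 1" and h: "\<And>j. cmod (h $ j) = 1"
  shows "inst_rate \<rho> (noisy_channel g h \<Phi>) =
    log 2 (Re (det (gram (\<rho> / real CARD('t)) (\<lambda>k. channel_row 1 (\<lambda>a. \<Phi> (a, k))) UNIV)))"
proof -
  let ?c = "\<rho> / real CARD('t)"
  let ?A = "noisy_channel g h \<Phi>"
  let ?w = "\<lambda>k. channel_row 1 (\<lambda>a. \<Phi> (a, k))"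
  have "det (mat 1 + ?c *\<^sub>R (?A ** cmat_adj ?A)) = det (transpose (gram ?c ?w UNIV))"
  proof (rule det_unimodular_scaling)
    show "cmod (g $ a) = 1" for a using g by simp
    fix a b
    have "?A $ a $ k * cnj (?A $ b $ k) = g $ a * (cnj (?w k $ b) * ?w k $ a) * cnj (g $ b)" for k
    proof -
      have "h $ k * cnj (h $ k) = 1" using h by (simp flip: complex_norm_square)
      then show ?thesis
        by (simp add: noisy_channel_def hadamard_def los_channel_def channel_row_def)
    qed
    then have "(?c *\<^sub>R (?A ** cmat_adj ?A)) $ a $ b =
        of_real ?c * (\<Sum>k\<in>UNIV. g $ a * (cnj (?w k $ b) * ?w k $ a) * cnj (g $ b))"
      by (simp only: matrix_matrix_mult_def cmat_adj_def vec_lambda_beta vector_scaleR_component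
          scaleR_conv_of_real[where 'a = complex])
    also have "\<dots> = g $ a * (of_real ?c * (\<Sum>k\<in>UNIV. cnj (?w k $ b) * ?w k $ a)) * cnj (g $ b)"
      by (simp add: sum_distrib_left sum_distrib_right mult_ac)
    finally show "(mat 1 + ?c *\<^sub>R (?A ** cmat_adj ?A)) $ a $ b =
        g $ a * transpose (gram ?c ?w UNIV) $ a $ b * cnj (g $ b)"
      using g[of b] by (simp add: gram_def mat_def transpose_def algebra_simps flip: complex_norm_square)
  qed
  then show ?thesis by (simp add: inst_rate_def)
qed

theorem theorem8:
  fixes g :: "complex^'r::finite" and h :: "complex^'t::finite"
    and \<rho> \<sigma>2 :: real
  assumes "\<rho> > 0" and "\<sigma>2 > 0"
    and "\<And>i. cmod (g $ i) = 1" and "\<And>j. cmod (h $ j) = 1"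
  shows "(CARD('r) \<le> CARD('t) \<longrightarrow>
           cap_hat \<rho> \<sigma>2 g h \<ge>
             (\<Sum>i<CARD('r). log 2 (1 + \<rho> / real CARD('t) *
                (real CARD('t) * real CARD('r) * (if i = 0 then 1 else 0)
                 + 2 * \<sigma>2 * exp (Digamma ((real CARD('t) - real i) / 2))))))
       \<and> (CARD('r) > CARD('t) \<longrightarrow>
           cap_hat \<rho> \<sigma>2 g h \<ge>
             (\<Sum>i<CARD('t). log 2 (1 + \<rho> / real CARD('t) *
                (real CARD('t) * real CARD('r) * (if i = 0 then 1 else 0)
                 + 2 * \<sigma>2 * exp (Digamma ((real CARD('r) - real i) / 2))))))"
proof (intro conjI impI)
  let ?c = "\<rho> / real CARD('t)"
  have c: "?c > 0" and s: "sqrt \<sigma>2 > 0" using assms by simp_all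
  \<comment> \<open>\<open>normal_density\<close> takes a standard deviation, so the general bound
    is used at \<open>sqrt \<sigma>2\<close>.\<close>
  have sq: "(sqrt \<sigma>2)\<^sup>2 = \<sigma>2" using assms by simp
  {
    assume "CARD('r) \<le> CARD('t)"
    from integral_ln_det_channel_ge[OF c s this bij_id]
    show "cap_hat \<rho> \<sigma>2 g h \<ge>
             (\<Sum>i<CARD('r). log 2 (1 + \<rho> / real CARD('t) *
                (real CARD('t) * real CARD('r) * (if i = 0 then 1 else 0)
                 + 2 * \<sigma>2 * exp (Digamma ((real CARD('t) - real i) / 2)))))"
      unfolding cap_hat_def inst_rate_eq_gram_rows[OF assms(3,4)] phase_noise_measure_def
      by (simp add: sq log_def divide_right_mono flip: sum_divide_distrib)
  next
    assume "CARD('r) > CARD('t)"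
    \<comment> \<open>Swapping the index pairs transposes the noise, so that the shorter dimension
      \<open>'t\<close> indexes the rows as the general bound requires.\<close>
    moreover have "bij (prod.swap :: 'r \<times> 't \<Rightarrow> _)" by (rule bij_swap)
    moreover have "inv (prod.swap :: 'r \<times> 't \<Rightarrow> _) = prod.swap" by (rule inv_equality) auto
    ultimately show "cap_hat \<rho> \<sigma>2 g h \<ge>
             (\<Sum>i<CARD('t). log 2 (1 + \<rho> / real CARD('t) *
                (real CARD('t) * real CARD('r) * (if i = 0 then 1 else 0)
                 + 2 * \<sigma>2 * exp (Digamma ((real CARD('r) - real i) / 2)))))"
      using integral_ln_det_channel_ge[OF c s, of "prod.swap :: 'r \<times> 't \<Rightarrow> _"]
      unfolding cap_hat_def inst_rate_eq_gram_columns[OF assms(3,4)] phase_noise_measure_def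
      by (simp add: sq log_def divide_right_mono mult.commute[of "real CARD('r)"] flip: sum_divide_distrib)
  }
qed

end
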